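(* Let $N,T>0$ and let $l:[0,\infty)\to[0,\infty)$ be continuous, strictly decreasing, with $l(x)>0$ for all $x\ge0$, $l(\cdot)\le1$ and $\int_0^\infty x\,l(x)\,dx<\infty$. Let $\Phi$ be a stationary, $\nu$-weakly sub-Poisson point process on $\mathbb{R}^2$ of positive finite intensity, and let $\Phi_I$ be an $\alpha$-weakly sub-Poisson point process on $\mathbb{R}^2$ with intensity $\mu$ for some $\mu>0$ (i.e. mean measure $\mu\|\cdot\|$), defined on the same probability space as $\Phi$ (independence of $\Phi$ and $\Phi_I$ is not assumed). Then there exist $P>0$ with $l(0)\ge TN/P$ and $\gamma>0$ such that the SINR graph $G(\Phi,\Phi_I,\gamma)$, with signal power $P$, noise $N$ and threshold $T$, percolates almost surely.
   Context: A point process on $\mathbb{R}^2$ is a random element of the space of Radon (locally finite) counting measures; we write $X\in\Phi$ for its points. It is stationary if its law is invariant under all translations. $\|\cdot\|$ denotes Lebesgue measure; the mean measure of $\Phi$ is $B\mapsto\mathsf{E}(\Phi(B))$. $\Phi$ is $\nu$-weakly sub-Poisson if $\mathsf{P}(\Phi(B)=0)\le e^{-\mathsf{E}(\Phi(B))}$ for every bounded Borel set $B$. $\Phi$ is $\alpha$-weakly sub-Poisson if $\mathsf{E}\big(\prod_{i=1}^n\Phi(B_i)\big)\le\prod_{i=1}^n\mathsf{E}(\Phi(B_i))$ for every $n\ge1$ and all mutually disjoint bounded Borel sets $B_1,\dots,B_n$. The interference at $x\in\mathbb{R}^2$ generated by a point process $\Phi$ is $I_\Phi(x):=\sum_{X\in\Phi\setminus\{x\}}l(|X-x|)$.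 For $P>0$, $\gamma\ge0$ and $x,y\in\mathbb{R}^2$, $$\mathrm{SINR}(x,y,\Phi,\gamma):=\frac{P\,l(|x-y|)}{N+\gamma P\,I_{\Phi\setminus\{x\}}(y)} .$$ For point processes $\Phi_B,\Phi_I$ on $\mathbb{R}^2$, the SINR graph $G(\Phi_B,\Phi_I,\gamma)$ has vertex set $\Phi_B$ and an edge between distinct $X,Y\in\Phi_B$ if and only if $\mathrm{SINR}(Y,X,\Phi_I,\gamma)>T$ and $\mathrm{SINR}(X,Y,\Phi_I,\gamma)>T$. A graph percolates if it has an infinite connected component. *)

theory Defs
  imports "HOL-Probability.Probability"
begin

section \<open>Point processes on the plane\<close>

text \<open>Integrality is required on bounded Borel sets only (so local finiteness is included); such a
  measure is a locally finite sum of Dirac measures, possibly with multiplicities.\<close>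

definition radon_counting_measures :: "(real^2) measure set" where
  "radon_counting_measures =
     {m. sets m = sets borel \<and>
         (\<forall>B\<in>sets borel. bounded B \<longrightarrow> emeasure m B \<in> range (of_nat :: nat \<Rightarrow> ennreal))}"

definition counting_measure_algebra :: "(real^2) measure measure" where
  "counting_measure_algebra =
     sigma radon_counting_measures
       {{m \<in> radon_counting_measures. emeasure m B \<in> A} | B A.
          B \<in> sets borel \<and> bounded B \<and> A \<in> sets borel}"

definition point_process :: "'w measure \<Rightarrow> ('w \<Rightarrow> (real^2) measure) \<Rightarrow> bool" where
  "point_process M \<Phi> \<longleftrightarrow> \<Phi> \<in> measurable M counting_measure_algebra"

definition translate :: "real^2 \<Rightarrow> (real^2) measure \<Rightarrow> (real^2) measure" where
  "translate v m = distr m borel (\<lambda>x. x + v)"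

text \<open>The two laws below are genuine image measures: see \<open>translate_measurable\<close>.\<close>

definition stationary :: "'w measure \<Rightarrow> ('w \<Rightarrow> (real^2) measure) \<Rightarrow> bool" where
  "stationary M \<Phi> \<longleftrightarrow>
     (\<forall>v. distr M counting_measure_algebra (\<lambda>\<omega>. translate v (\<Phi> \<omega>))
        = distr M counting_measure_algebra \<Phi>)"

definition mean_count :: "'w measure \<Rightarrow> ('w \<Rightarrow> (real^2) measure) \<Rightarrow> (real^2) set \<Rightarrow> ennreal" where
  "mean_count M \<Phi> B = (\<integral>\<^sup>+\<omega>. emeasure (\<Phi> \<omega>) B \<partial>M)"

definition has_intensity :: "'w measure \<Rightarrow> ('w \<Rightarrow> (real^2) measure) \<Rightarrow> real \<Rightarrow> bool" where
  "has_intensity M \<Phi> c \<longleftrightarrow>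
     (\<forall>B\<in>sets borel. mean_count M \<Phi> B = ennreal c * emeasure lborel B)"

text \<open>The case distinction is the convention \<open>exp (- \<infinity>) = 0\<close>.\<close>

definition nu_weakly_sub_poisson :: "'w measure \<Rightarrow> ('w \<Rightarrow> (real^2) measure) \<Rightarrow> bool" where
  "nu_weakly_sub_poisson M \<Phi> \<longleftrightarrow>
     (\<forall>B\<in>sets borel. bounded B \<longrightarrow>
        measure M {\<omega> \<in> space M. emeasure (\<Phi> \<omega>) B = 0}
          \<le> (if mean_count M \<Phi> B = \<infinity> then 0 else exp (- enn2real (mean_count M \<Phi> B))))"

definition alpha_weakly_sub_poisson :: "'w measure \<Rightarrow> ('w \<Rightarrow> (real^2) measure) \<Rightarrow> bool" where
  "alpha_weakly_sub_poisson M \<Phi> \<longleftrightarrow>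
     (\<forall>(n::nat) B. n \<ge> 1 \<longrightarrow> (\<forall>i<n. B i \<in> sets borel \<and> bounded (B i)) \<longrightarrow>
        disjoint_family_on B {..<n} \<longrightarrow>
        (\<integral>\<^sup>+\<omega>. (\<Prod>i<n. emeasure (\<Phi> \<omega>) (B i)) \<partial>M) \<le> (\<Prod>i<n. mean_count M \<Phi> (B i)))"

lemma translate_measurable:
  "translate v \<in> measurable counting_measure_algebra counting_measure_algebra"
proof -
  let ?G = "{{m \<in> radon_counting_measures. emeasure m B \<in> A} | B A.
          B \<in> sets borel \<and> bounded B \<and> A \<in> sets (borel :: ennreal measure)}"
  have G: "?G \<subseteq> Pow radon_counting_measures" by auto
  have sp: "space counting_measure_algebra = radon_counting_measures"
    unfolding counting_measure_algebra_def using G by (simp add: space_measure_of)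
  have em: "emeasure (translate v m) B = emeasure m ((\<lambda>x. x + v) -` B)"
    and B': "(\<lambda>x. x + v) -` B \<in> sets borel"
    if "m \<in> radon_counting_measures" "B \<in> sets borel" for m and B :: "(real^2) set"
  proof -
    have [measurable_cong]: "sets m = sets borel"
      using that by (simp add: radon_counting_measures_def)
    have [simp]: "space m = UNIV" using sets_eq_imp_space_eq[of m borel] that
      by (simp add: radon_counting_measures_def)
    show "emeasure (translate v m) B = emeasure m ((\<lambda>x. x + v) -` B)"
      unfolding translate_def using that(2) by (subst emeasure_distr) auto
    have "(\<lambda>x::real^2. x + v) \<in> borel_measurable borel" by simp
    from measurable_sets[OF this that(2)] show "(\<lambda>x. x + v) -` B \<in> sets borel" by simp
  qed
  have bd: "bounded ((\<lambda>x. x + v) -` B)" if "bounded B" for B :: "(real^2) set"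
  proof -
    have "(\<lambda>x. x + v) -` B = (\<lambda>x. -v + x) ` B"
    proof (intro equalityI subsetI)
      fix x assume "x \<in> (\<lambda>x. x + v) -` B"
      then show "x \<in> (\<lambda>x. -v + x) ` B" by (intro image_eqI[of _ _ "x + v"]) auto
    qed auto
    then show ?thesis using bounded_translation[OF that, of "-v"] by simp
  qed
  have clo: "translate v m \<in> radon_counting_measures" if "m \<in> radon_counting_measures" for m
    using that em[OF that] B'[OF that] bd
    unfolding radon_counting_measures_def by (auto simp: translate_def)
  show ?thesis
    unfolding counting_measure_algebra_def
  proof (rule measurable_measure_of[OF G])
    show "translate v \<in> space (sigma radon_counting_measures ?G) \<rightarrow> radon_counting_measures"
      using clo G by (auto simp: space_measure_of)
    fix y assume "y \<in> ?G"
    then obtain B A where y: "y = {m \<in> radon_counting_measures. emeasure m B \<in> A}"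
      and BA: "B \<in> sets borel" "bounded B" "A \<in> sets borel" by blast
    have "translate v -` y \<inter> radon_counting_measures
        = {m \<in> radon_counting_measures. emeasure m ((\<lambda>x. x + v) -` B) \<in> A}"
      unfolding y using clo em BA by auto
    also have "\<dots> \<in> sets (sigma radon_counting_measures ?G)"
    proof (cases "radon_counting_measures = {}")
      case False
      then show ?thesis using B' bd BA by (intro in_measure_of[OF G]) blast
    qed simp
    finally show "translate v -` y \<inter> space (sigma radon_counting_measures ?G)
        \<in> sets (sigma radon_counting_measures ?G)"
      using G by (simp add: space_measure_of)
  qed
qed

section \<open>The SINR graph\<close>

definition points :: "(real^2) measure \<Rightarrow> (real^2) set" where
  "points m = {x. emeasure m {x} \<noteq> 0}"

definition remove_point :: "real^2 \<Rightarrow> (real^2) measure \<Rightarrow> (real^2) measure" where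
  "remove_point x m = density m (indicator (- {x}))"

text \<open>The sum over the points of a counting measure is the integral with respect to it, so points
  are counted with their multiplicities; the value may be infinite.\<close>

definition interference :: "(real \<Rightarrow> real) \<Rightarrow> (real^2) measure \<Rightarrow> real^2 \<Rightarrow> ennreal" where
  "interference l m x = (\<integral>\<^sup>+z. ennreal (l (norm (z - x))) \<partial>(remove_point x m))"

text \<open>The ratio is 0 where the interference is infinite (and \<open>\<gamma> * P > 0\<close>).\<close>

definition sinr :: "(real \<Rightarrow> real) \<Rightarrow> real \<Rightarrow> real \<Rightarrow> real^2 \<Rightarrow> real^2 \<Rightarrow> (real^2) measure \<Rightarrow> real \<Rightarrow> ennreal" where
  "sinr l N P x y m \<gamma> =
     ennreal (P * l (norm (x - y))) /
       (ennreal N + ennreal (\<gamma> * P) * interference l (remove_point x m) y)"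

text \<open>A graph is a pair of a vertex set and a symmetric edge relation on it.\<close>

definition sinr_graph ::
  "(real \<Rightarrow> real) \<Rightarrow> real \<Rightarrow> real \<Rightarrow> real \<Rightarrow> (real^2) measure \<Rightarrow> (real^2) measure \<Rightarrow> real
     \<Rightarrow> (real^2) set \<times> (real^2) rel" where
  "sinr_graph l N P T mB mI \<gamma> =
     (points mB,
      {(X, Y). X \<in> points mB \<and> Y \<in> points mB \<and> X \<noteq> Y \<and>
               sinr l N P Y X mI \<gamma> > ennreal T \<and> sinr l N P X Y mI \<gamma> > ennreal T})"

definition graph_components :: "'a set \<times> 'a rel \<Rightarrow> 'a set set" where
  "graph_components G = {{y. (x, y) \<in> (snd G)\<^sup>*} | x. x \<in> fst G}"

definition percolates :: "'a set \<times> 'a rel \<Rightarrow> bool" where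
  "percolates G \<longleftrightarrow> (\<exists>C\<in>graph_components G. infinite C)"

end

theory Submission
  imports Defs
begin

text \<open>
  The plane is cut into cells of side \<open>s\<close>, and \<open>7 ^ k \<times> 7 ^ k\<close> cells form a box of level \<open>k\<close>. A cell is
  bad if it contains no point of the vertex process or if there are too many interferers around it.
  A box of level \<open>k + 1\<close> is bad if its surroundings carry too many interferers on its own scale, or if
  two of its sub-boxes at distance at least 3 are bad. The bad sub-boxes of a good box
  therefore meet at most 3 of its 7 rows and 3 of its 7 columns, so the fully good rows and columns
  form a connected grid which overlaps with that of each adjacent good box. This replaces planar
  duality.

  Badness unfolds into a binary tree of elementary events, which live on disjoint regions. For a
  multiple point process the \<open>\<alpha>\<close>-condition says nothing about higher moments of a single count, but
  Markov's inequality for the product of counts of disjoint regions suffices here. Since the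
  two processes may be dependent, the probability of a tree containing both kinds of events is
  bounded by the geometric mean of the two separate bounds.

  The probability that a box of level \<open>k\<close> is bad then satisfies \<open>v (k + 1) \<le> v k / 8 + \<epsilon> (k + 1)\<close>, and
  integrability of \<open>x * l x\<close> makes the bounds summable. By Borel--Cantelli all boxes
  of level \<open>k\<close> near the origin are eventually good, and their grids join to an infinite
  connected set of cells with bounded interference.
\<close>

section \<open>Connected cores of good boxes\<close>

type_synonym cell = "int \<times> int"

section \<open>Connectedness of sets and of indexed unions\<close>

definition con :: "'a rel \<Rightarrow> 'a set \<Rightarrow> bool" where
  "con R S \<longleftrightarrow> (\<forall>a\<in>S. \<forall>b\<in>S. (a, b) \<in> (R \<inter> S \<times> S)\<^sup>*)"

lemma con_mono_path: "con R S \<Longrightarrow> S \<subseteq> T \<Longrightarrow> a \<in> S \<Longrightarrow> b \<in> S \<Longrightarrow> (a, b) \<in> (R \<inter> T \<times> T)\<^sup>*"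
  unfolding con_def using rtrancl_mono[of "R \<inter> S \<times> S" "R \<inter> T \<times> T"] by blast

lemma con_Un:
  assumes "con R S" "con R T" "z \<in> S" "z \<in> T"
  shows "con R (S \<union> T)"
proof -
  have "(a, z) \<in> (R \<inter> (S \<union> T) \<times> (S \<union> T))\<^sup>*" "(z, a) \<in> (R \<inter> (S \<union> T) \<times> (S \<union> T))\<^sup>*"
    if "a \<in> S \<union> T" for a
    using that con_mono_path[OF assms(1) Un_upper1] con_mono_path[OF assms(2) Un_upper2] assms(3,4)
    by auto
  then show ?thesis unfolding con_def by (meson rtrancl_trans)
qed

text \<open>A path of indices lifts to the union: each index step is a path inside
  \<open>F i \<union> F j\<close>, and nonemptiness supplies the points at which consecutive pieces
  are joined. The case \<open>i = j\<close> of the hypothesis covers a single piece. The index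
  relation is \<open>adj\<close> for the grid in a box and the neighbour relation of naturals for
  the chain of levels.\<close>

lemma con_UN:
  assumes I: "con R I" and ne: "\<And>i. i \<in> I \<Longrightarrow> F i \<noteq> {}"
    and step: "\<And>i j. i \<in> I \<Longrightarrow> j \<in> I \<Longrightarrow> i = j \<or> (i, j) \<in> R \<Longrightarrow> con A (F i \<union> F j)"
  shows "con A (\<Union>i\<in>I. F i)"
proof -
  let ?S = "\<Union>i\<in>I. F i"
  have "\<forall>b\<in>F j. (a, b) \<in> (A \<inter> ?S \<times> ?S)\<^sup>*" if "(i, j) \<in> (R \<inter> I \<times> I)\<^sup>*" "i \<in> I" "a \<in> F i" for i j a
    using that(1)
  proof (induction rule: rtrancl_induct)
    case base
    show ?case
      using con_mono_path[OF step[of i i], of ?S a] that by auto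
  next
    case (step j j')
    then have j: "j \<in> I" "j' \<in> I" "(j, j') \<in> R" by auto
    obtain b' where b': "b' \<in> F j" using ne[OF j(1)] by auto
    have "(b', b) \<in> (A \<inter> ?S \<times> ?S)\<^sup>*" if "b \<in> F j'" for b
      using con_mono_path[OF assms(3)[of j j'], of ?S b' b] j b' that by auto
    with step.IH b' show ?case by (meson rtrancl_trans)
  qed
  then show ?thesis unfolding con_def using I[unfolded con_def] by (metis (no_types, lifting) UN_E)
qed

section \<open>Adjacency, distance and the hierarchy of boxes\<close>

definition adj :: "cell rel" where
  "adj = {(x, y). \<bar>fst x - fst y\<bar> + \<bar>snd x - snd y\<bar> \<le> 1}"

text \<open>The threshold 3 is the least one for which the 3 x 3 blocks around two boxes are
  disjoint; \<open>region_far\<close> rests on this.\<close>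

definition far :: "cell \<Rightarrow> cell \<Rightarrow> bool" where
  "far x y \<longleftrightarrow> \<bar>fst x - fst y\<bar> \<ge> 3 \<or> \<bar>snd x - snd y\<bar> \<ge> 3"

definition near :: "cell \<Rightarrow> cell \<Rightarrow> bool" where
  "near x y \<longleftrightarrow> \<bar>fst x - fst y\<bar> \<le> 1 \<and> \<bar>snd x - snd y\<bar> \<le> 1"

text \<open>The base 7 is the least number exceeding 3 + 3, the number of rows that the bad
  sub-boxes of two good boxes can block together.\<close>

definition par :: "cell \<Rightarrow> cell" where
  "par x = (fst x div 7, snd x div 7)"

definition anc :: "nat \<Rightarrow> cell \<Rightarrow> cell" where
  "anc k x = (fst x div 7 ^ k, snd x div 7 ^ k)"

lemma anc_0 [simp]: "anc 0 x = x"
  by (simp add: anc_def)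

lemma anc_Suc: "anc (Suc k) x = par (anc k x)"
  by (simp add: anc_def par_def zdiv_zmult2_eq mult.commute[of 7])

lemma par_0 [simp]: "par (0, 0) = (0, 0)"
  by (simp add: par_def)

lemma near_par: "near x y \<Longrightarrow> near (par x) (par y)"
  by (auto simp: near_def par_def)

lemma path_line:
  fixes f :: "int \<Rightarrow> cell"
  assumes "\<And>i. a \<le> i \<Longrightarrow> i \<le> b \<Longrightarrow> f i \<in> S" "\<And>i. (f i, f (i + 1)) \<in> adj"
    and "i \<in> {a..b}" "j \<in> {a..b}"
  shows "(f i, f j) \<in> (adj \<inter> S \<times> S)\<^sup>*"
proof -
  have *: "(f i, f j) \<in> (adj \<inter> S \<times> S)\<^sup>*" if "a \<le> i" "i \<le> j" "j \<le> b" for i j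
    using that(2,1,3)
  proof (induction rule: int_ge_induct)
    case (step j)
    then have "(f i, f j) \<in> (adj \<inter> S \<times> S)\<^sup>*" by simp
    moreover have "(f j, f (j + 1)) \<in> adj \<inter> S \<times> S"
      using assms(1)[of j] assms(1)[of "j + 1"] assms(2)[of j] step.hyps step.prems by simp
    ultimately show ?case by (rule rtrancl_into_rtrancl)
  qed simp
  have s: "sym ((adj \<inter> S \<times> S)\<^sup>*)"
    by (intro sym_rtrancl) (auto simp: sym_def adj_def)
  show ?thesis using *[of i j] *[of j i] assms(3,4) symD[OF s, of "f j" "f i"] by (cases "i \<le> j") auto
qed

definition clustered :: "(cell \<Rightarrow> bool) \<Rightarrow> cell \<Rightarrow> bool" where
  "clustered B x \<longleftrightarrow> (\<forall>y y'. par y = x \<and> par y' = x \<and> B y \<and> B y' \<longrightarrow> \<not> far y y')"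

definition okset :: "(cell \<Rightarrow> bool) \<Rightarrow> cell \<Rightarrow> cell set" where
  "okset B x = {y. par y = x \<and> ((\<forall>y'. par y' = x \<and> fst y' = fst y \<longrightarrow> \<not> B y') \<or>
                                 (\<forall>y'. par y' = x \<and> snd y' = snd y \<longrightarrow> \<not> B y'))}"

lemma okset_par: "y \<in> okset B x \<Longrightarrow> par y = x"
  by (simp add: okset_def)

lemma okset_good: "y \<in> okset B x \<Longrightarrow> \<not> B y"
  unfolding okset_def by blast

lemma okset_all: "(\<And>y. par y = x \<Longrightarrow> \<not> B y) \<Longrightarrow> okset B x = {y. par y = x}"
  by (auto simp: okset_def)

lemma okset_antimono: "(\<And>y. B y \<Longrightarrow> B' y) \<Longrightarrow> okset B' x \<subseteq> okset B x"
  unfolding okset_def by blast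

text \<open>Within \<open>{0..6}\<close> each set lies in an interval \<open>{m..m+2}\<close> above
  its minimum, so the two together block at most 6 of the 7 values.\<close>

lemma avoid_two_clusters:
  fixes R R' :: "int set"
  assumes "\<And>i j. i \<in> R \<Longrightarrow> j \<in> R \<Longrightarrow> \<bar>i - j\<bar> < 3" "\<And>i j. i \<in> R' \<Longrightarrow> j \<in> R' \<Longrightarrow> \<bar>i - j\<bar> < 3"
  shows "\<exists>i\<in>{0..6}. i \<notin> R \<and> i \<notin> R'"
proof -
  have *: "card (Q \<inter> {0..6}) \<le> 3" if Q: "\<And>i j. i \<in> Q \<Longrightarrow> j \<in> Q \<Longrightarrow> \<bar>i - j\<bar> < 3" for Q :: "int set"
  proof (cases "Q \<inter> {0..6} = {}")
    case False
    define m where "m = Min (Q \<inter> {0..6})"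
    have m: "m \<in> Q \<inter> {0..6}" "\<And>i. i \<in> Q \<inter> {0..6} \<Longrightarrow> m \<le> i"
      unfolding m_def using False Min_in[of "Q \<inter> {0..6}"] by auto
    have "Q \<inter> {0..6} \<subseteq> {m..m+2}"
      using m Q[of m] by force
    then have "card (Q \<inter> {0..6}) \<le> card {m..m+2}" by (intro card_mono) auto
    then show ?thesis by simp
  qed simp
  show ?thesis
  proof (rule ccontr)
    assume "\<not> ?thesis"
    then have "{0..6} \<subseteq> (R \<inter> {0..6}) \<union> (R' \<inter> {0..6})" by auto
    then have "card {0..6::int} \<le> card ((R \<inter> {0..6}) \<union> (R' \<inter> {0..6}))"
      by (intro card_mono) auto
    also have "\<dots> \<le> 3 + 3"
      using *[of R] *[of R'] assms card_Un_le[of "R \<inter> {0..6}" "R' \<inter> {0..6}"] by force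
    finally show False by simp
  qed
qed

lemma par_eq: "par y = x \<longleftrightarrow> fst y \<in> {7 * fst x..7 * fst x + 6} \<and> snd y \<in> {7 * snd x..7 * snd x + 6}"
proof -
  have "n div 7 = m \<longleftrightarrow> n \<in> {7 * m..7 * m + 6}" for m n :: int by auto
  then show ?thesis by (simp add: par_def prod_eq_iff)
qed

text \<open>By \<open>avoid_two_clusters\<close> some row offset \<open>r\<close> and some column
  offset \<open>c\<close> are free of bad sub-boxes in both boxes at once. Every element of the grid
  lies on a free row or column of its own box, follows it to column \<open>c\<close> or row
  \<open>r\<close>, and from there reaches the hub at their crossing. The case \<open>x = x'\<close>
  gives the connectedness of a single grid.\<close>

lemma con_okset:
  assumes "x = x' \<or> (x, x') \<in> adj" "clustered B x" "clustered B x'"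
  shows "con adj (okset B x \<union> okset B x')" "okset B x \<noteq> {}"
proof -
  define row where "row x i \<longleftrightarrow> (\<exists>y. par y = x \<and> snd y = 7 * snd x + i \<and> B y)" for x i
  define col where "col x i \<longleftrightarrow> (\<exists>y. par y = x \<and> fst y = 7 * fst x + i \<and> B y)" for x i
  have rowc: "\<bar>i - j\<bar> < 3" if cl: "clustered B x" and ij: "row x i" "row x j" for x i j
  proof -
    obtain y where y: "par y = x" "snd y = 7 * snd x + i" "B y" using ij(1) unfolding row_def by blast
    obtain y' where y': "par y' = x" "snd y' = 7 * snd x + j" "B y'" using ij(2) unfolding row_def by blast
    have "\<not> far y y'" using cl y y' unfolding clustered_def by blast
    then show ?thesis using y y' unfolding far_def by simp
  qed
  have colc: "\<bar>i - j\<bar> < 3" if cl: "clustered B x" and ij: "col x i" "col x j" for x i j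
  proof -
    obtain y where y: "par y = x" "fst y = 7 * fst x + i" "B y" using ij(1) unfolding col_def by blast
    obtain y' where y': "par y' = x" "fst y' = 7 * fst x + j" "B y'" using ij(2) unfolding col_def by blast
    have "\<not> far y y'" using cl y y' unfolding clustered_def by blast
    then show ?thesis using y y' unfolding far_def by simp
  qed
  obtain r where r: "r \<in> {0..6}" "\<not> row x r" "\<not> row x' r"
    using avoid_two_clusters[of "{i. row x i}" "{i. row x' i}"] rowc assms(2,3) by auto
  obtain c where c: "c \<in> {0..6}" "\<not> col x c" "\<not> col x' c"
    using avoid_two_clusters[of "{i. col x i}" "{i. col x' i}"] colc assms(2,3) by auto
  let ?S = "okset B x \<union> okset B x'"
  let ?R = "(adj \<inter> ?S \<times> ?S)\<^sup>*"
  define hub where "hub z = (7 * fst z + c, 7 * snd z + r)" for z :: cell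
  have okr: "(7 * fst z + i, 7 * snd z + j) \<in> okset B z" if "\<not> row z j" "i \<in> {0..6}" "j \<in> {0..6}" for z i j
  proof -
    have "par (7 * fst z + i, 7 * snd z + j) = z" using that by (simp add: par_eq)
    then show ?thesis using that(1) unfolding okset_def row_def by auto
  qed
  have okc: "(7 * fst z + i, 7 * snd z + j) \<in> okset B z" if "\<not> col z i" "i \<in> {0..6}" "j \<in> {0..6}" for z i j
  proof -
    have "par (7 * fst z + i, 7 * snd z + j) = z" using that by (simp add: par_eq)
    then show ?thesis using that(1) unfolding okset_def col_def by auto
  qed
  have sym: "sym ?R" by (intro sym_rtrancl) (auto simp: sym_def adj_def)
  have rowpath: "((7 * fst z + i, 7 * snd z + j), (7 * fst z + i', 7 * snd z + j)) \<in> ?R"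
    if "z \<in> {x, x'}" "\<not> row z j" "i \<in> {0..6}" "i' \<in> {0..6}" "j \<in> {0..6}" for z i i' j
    using okr[OF that(2) _ that(5)] that
    by (intro path_line[of 0 6 "\<lambda>i. (7 * fst z + i, 7 * snd z + j)"]) (auto simp: adj_def)
  have colpath: "((7 * fst z + i, 7 * snd z + j), (7 * fst z + i, 7 * snd z + j')) \<in> ?R"
    if "z \<in> {x, x'}" "\<not> col z i" "i \<in> {0..6}" "j' \<in> {0..6}" "j \<in> {0..6}" for z i j j'
    using okc[OF that(2) that(3)] that
    by (intro path_line[of 0 6 "\<lambda>j. (7 * fst z + i, 7 * snd z + j)"]) (auto simp: adj_def)
  have toh: "(y, hub z) \<in> ?R" if z: "z \<in> {x, x'}" and y: "y \<in> okset B z" for y z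
  proof -
    define i j where "i = fst y - 7 * fst z" and "j = snd y - 7 * snd z"
    have ij: "i \<in> {0..6}" "j \<in> {0..6}" using okset_par[OF y] unfolding par_eq i_def j_def by auto
    have yeq: "y = (7 * fst z + i, 7 * snd z + j)" by (simp add: i_def j_def)
    have "\<not> row z j \<or> \<not> col z i"
      using y unfolding okset_def row_def col_def i_def j_def by auto
    then show ?thesis
    proof
      assume "\<not> row z j"
      then have "(y, (7 * fst z + c, 7 * snd z + j)) \<in> ?R"
        unfolding yeq using rowpath z ij c by blast
      also have "((7 * fst z + c, 7 * snd z + j), hub z) \<in> ?R"
        unfolding hub_def using colpath z ij c r by blast
      finally show ?thesis .
    next
      assume "\<not> col z i"
      then have "(y, (7 * fst z + i, 7 * snd z + r)) \<in> ?R"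
        unfolding yeq using colpath z ij r by blast
      also have "((7 * fst z + i, 7 * snd z + r), hub z) \<in> ?R"
        unfolding hub_def using rowpath z ij c r by blast
      finally show ?thesis .
    qed
  qed
  \<comment> \<open>Adjacent boxes agree in one coordinate. The common free row or column then runs
    straight through both boxes, without leaving the union of the two grids.\<close>
  have hubs: "(hub x, hub x') \<in> ?R"
  proof -
    consider "snd x = snd x'" "\<bar>fst x - fst x'\<bar> \<le> 1" | "fst x = fst x'" "\<bar>snd x - snd x'\<bar> \<le> 1"
      using assms(1) unfolding adj_def by fastforce
    then show ?thesis
    proof cases
      case 1
      have mem: "(i, 7 * snd x + r) \<in> ?S" if "7 * min (fst x) (fst x') \<le> i" "i \<le> 7 * max (fst x) (fst x') + 6" for i
      proof -
        have "i - 7 * fst x \<in> {0..6} \<or> i - 7 * fst x' \<in> {0..6}" using that 1 by auto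
        then show ?thesis using okr[OF r(2) _ r(1), of "i - 7 * fst x"] okr[OF r(3) _ r(1), of "i - 7 * fst x'"] 1(1) by auto
      qed
      have "((7 * fst x + c, 7 * snd x + r), (7 * fst x' + c, 7 * snd x + r)) \<in> ?R"
        using c(1) by (intro path_line[OF mem]) (auto simp: adj_def)
      then show ?thesis unfolding hub_def 1(1) .
    next
      case 2
      have mem: "(7 * fst x + c, i) \<in> ?S" if "7 * min (snd x) (snd x') \<le> i" "i \<le> 7 * max (snd x) (snd x') + 6" for i
      proof -
        have "i - 7 * snd x \<in> {0..6} \<or> i - 7 * snd x' \<in> {0..6}" using that 2 by auto
        then show ?thesis using okc[OF c(2) c(1), of "i - 7 * snd x"] okc[OF c(3) c(1), of "i - 7 * snd x'"] 2(1) by auto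
      qed
      have "((7 * fst x + c, 7 * snd x + r), (7 * fst x + c, 7 * snd x' + r)) \<in> ?R"
        using r(1) by (intro path_line[OF mem]) (auto simp: adj_def)
      then show ?thesis unfolding hub_def 2(1) .
    qed
  qed
  have "(y, hub x) \<in> ?R" if "y \<in> ?S" for y
    using that toh[of x y] toh[of x' y] symD[OF sym hubs] by (auto intro: rtrancl_trans)
  then show "con adj ?S" unfolding con_def using symD[OF sym] by (meson rtrancl_trans)
  show "okset B x \<noteq> {}" using okr[OF r(2) c(1) r(1)] by auto
qed

section \<open>Recursive badness and the cores of good boxes\<close>

fun bad :: "(cell \<Rightarrow> bool) \<Rightarrow> (nat \<Rightarrow> cell \<Rightarrow> bool) \<Rightarrow> nat \<Rightarrow> cell \<Rightarrow> bool" where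
  "bad e D 0 x \<longleftrightarrow> e x \<or> D 0 x"
| "bad e D (Suc k) x \<longleftrightarrow> D (Suc k) x \<or> \<not> clustered (bad e D k) x"

fun core :: "(cell \<Rightarrow> bool) \<Rightarrow> (nat \<Rightarrow> cell \<Rightarrow> bool) \<Rightarrow> nat \<Rightarrow> cell \<Rightarrow> cell set" where
  "core e D 0 x = {x}"
| "core e D (Suc k) x = (\<Union>y\<in>okset (bad e D k) x. core e D k y)"

lemma clustered_antimono: "(\<And>y. B y \<Longrightarrow> B' y) \<Longrightarrow> clustered B' x \<Longrightarrow> clustered B x"
  unfolding clustered_def by blast

lemma bad_mono: "(\<And>j y. D j y \<Longrightarrow> D' j y) \<Longrightarrow> bad e D k x \<Longrightarrow> bad e D' k x"
proof (induction k arbitrary: x)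
  case (Suc k)
  have "bad e D k y \<Longrightarrow> bad e D' k y" for y using Suc by blast
  then show ?case
    using clustered_antimono[of "bad e D k" "bad e D' k" x] Suc.prems(1)[of "Suc k" x] Suc.prems(2) by auto
qed auto

text \<open>Fewer crowded regions mean fewer bad boxes, hence larger grids at every level. This
  compares the cores built with the thresholds of two consecutive top levels.\<close>

lemma core_antimono: "(\<And>j y. D j y \<Longrightarrow> D' j y) \<Longrightarrow> core e D' k x \<subseteq> core e D k x"
proof (induction k arbitrary: x)
  case (Suc k)
  have "okset (bad e D' k) x \<subseteq> okset (bad e D k) x"
    using bad_mono[of D D', OF Suc.prems] by (intro okset_antimono) blast
  with Suc show ?case by (auto; blast)
qed simp

lemma bad_imp_disc: "D k x \<Longrightarrow> bad e D k x"
  by (cases k) auto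

text \<open>Simultaneous induction on the level: \<open>con_okset\<close> connects the sub-boxes of
  the two grids, and the induction hypothesis connects the cores of equal or adjacent sub-boxes, so
  \<open>con_UN\<close> applies. Its nonemptiness condition is the first claim.\<close>

lemma
  shows core_nonempty: "\<not> bad e D k x \<Longrightarrow> core e D k x \<noteq> {}"
    and con_core: "\<not> bad e D k x \<Longrightarrow> \<not> bad e D k x' \<Longrightarrow> x = x' \<or> (x, x') \<in> adj \<Longrightarrow>
      con adj (core e D k x \<union> core e D k x')"
proof (induction k arbitrary: x x')
  case 0
  {
    case 1
    then show ?case by simp
  next
    case 2
    then have "(x, x') \<in> adj" "(x', x) \<in> adj" by (auto simp: adj_def)
    then show ?case unfolding con_def by (auto intro!: r_into_rtrancl)
  }
next
  case (Suc k)
  {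
    case 1
    then have cl: "clustered (bad e D k) x" by simp
    obtain y where y: "y \<in> okset (bad e D k) x" using con_okset(2)[OF _ cl cl] by blast
    then show ?case using Suc.IH(1)[OF okset_good[OF y]] by auto
  next
    case 2
    then have cl: "clustered (bad e D k) x" "clustered (bad e D k) x'" by simp_all
    have "con adj (\<Union>y\<in>okset (bad e D k) x \<union> okset (bad e D k) x'. core e D k y)"
    proof (rule con_UN[OF con_okset(1)[OF 2(3) cl]])
      fix i assume "i \<in> okset (bad e D k) x \<union> okset (bad e D k) x'"
      then show "core e D k i \<noteq> {}" using Suc.IH(1) okset_good by (metis UnE)
    next
      fix i j assume "i \<in> okset (bad e D k) x \<union> okset (bad e D k) x'"
        "j \<in> okset (bad e D k) x \<union> okset (bad e D k) x'" "i = j \<or> (i, j) \<in> adj"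
      then show "con adj (core e D k i \<union> core e D k j)" using Suc.IH(2) okset_good by (metis UnE)
    qed
    then show ?case by (simp add: UN_Un)
  }
qed

lemma core_anc: "z \<in> core e D k x \<Longrightarrow> anc k z = x"
  by (induction k arbitrary: x) (auto simp: anc_Suc dest: okset_par)

text \<open>Descending into a core passes through good boxes only. A core cell is therefore
  controlled at all scales up to \<open>k\<close> simultaneously, which is what bounds its
  interference.\<close>

lemma core_good: "z \<in> core e D k x \<Longrightarrow> \<not> bad e D k x \<Longrightarrow> j \<le> k \<Longrightarrow> \<not> bad e D j (anc j z)"
proof (induction k arbitrary: x)
  case (Suc k)
  then obtain y where y: "y \<in> okset (bad e D k) x" "z \<in> core e D k y" by auto
  show ?case
  proof (cases "j = Suc k")
    case True
    then show ?thesis using core_anc[OF Suc.prems(1)] Suc.prems(2) by (simp del: core.simps bad.simps)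
  next
    case False
    then show ?thesis using Suc.IH[OF y(2) okset_good[OF y(1)]] Suc.prems(3) by simp
  qed
qed auto

text \<open>The disc thresholds depend on the level \<open>k\<close> of the largest box, hence the family \<open>D k\<close>, which is
  increasing in \<open>k\<close>.\<close>

lemma infinite_core_union:
  assumes mono: "\<And>k j x. k0 \<le> k \<Longrightarrow> D k j x \<Longrightarrow> D (Suc k) j x"
    and good: "\<And>k y. k0 \<le> k \<Longrightarrow> par y = (0, 0) \<Longrightarrow> \<not> bad e (D k) k y"
  defines "S \<equiv> \<Union>k\<in>{k0..}. \<Union>y\<in>{y. par y = (0, 0)}. core e (D k) k y"
  shows "con adj S" "infinite S"
proof -
  \<comment> \<open>\<open>U k\<close> collects the cores of the 49 boxes of level \<open>k\<close>
    inside the box \<open>(0, 0)\<close> of level \<open>k + 1\<close>. As all of them are good, the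
    grid is the whole 7 x 7 square.\<close>
  define U where "U k = (\<Union>y\<in>{y. par y = (0, 0)}. core e (D k) k y)" for k
  have ok: "okset (bad e (D k) k) (0, 0) = {y. par y = (0, 0)}" if "k0 \<le> k" for k
    using good[OF that] by (rule okset_all)
  have cl: "clustered (bad e (D k) k) (0, 0)" if "k0 \<le> k" for k
    using good[OF that] unfolding clustered_def by auto
  have conU: "con adj (U k)" if "k0 \<le> k" for k
  proof -
    have "con adj {y. par y = (0, 0)}"
      using con_okset(1)[of "(0, 0)" "(0, 0)", OF _ cl[OF that] cl[OF that]] ok[OF that] by simp
    then show ?thesis unfolding U_def
      using con_core core_nonempty good[OF that] by (intro con_UN[of adj]) auto
  qed
  have neU: "U k \<noteq> {}" if "k0 \<le> k" for k
    unfolding U_def using core_nonempty[OF good[OF that par_0]] par_0 by blast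
  \<comment> \<open>The box \<open>(0, 0)\<close> is its own parent, so its core of level
    \<open>k + 1\<close> is part of \<open>U (Suc k)\<close>. That core consists of cores of level
    \<open>k\<close> for the thresholds \<open>D (Suc k)\<close>, which are contained in those for
    \<open>D k\<close>, hence in \<open>U k\<close>.\<close>
  have meet: "U k \<inter> U (Suc k) \<noteq> {}" if k: "k0 \<le> k" for k
  proof -
    have g: "\<not> bad e (D (Suc k)) (Suc k) (0, 0)" using k by (intro good) auto
    from core_nonempty[OF g]
    obtain z y where z: "z \<in> core e (D (Suc k)) k y" "y \<in> okset (bad e (D (Suc k)) k) (0, 0)" by auto
    then have "z \<in> core e (D (Suc k)) (Suc k) (0, 0)" by auto
    then have "z \<in> U (Suc k)" unfolding U_def using par_0 by blast
    moreover have "z \<in> U k" unfolding U_def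
      using z okset_par[OF z(2)] core_antimono[of "D k" "D (Suc k)" e k y] mono[OF k] by blast
    ultimately show ?thesis by auto
  qed
  have join: "con adj (U k \<union> U (Suc k))" if k: "k0 \<le> k" for k
  proof -
    obtain z where "z \<in> U k" "z \<in> U (Suc k)" using meet[OF k] by auto
    then show ?thesis using k by (intro con_Un conU) auto
  qed
  define R where "R = {(i, j). j = Suc i \<or> i = Suc j}"
  have "con R {k0..}"
  proof -
    have up: "(k0, k) \<in> (R \<inter> {k0..} \<times> {k0..})\<^sup>*" if "k0 \<le> k" for k
      using that
    proof (induction rule: dec_induct)
      case (step n)
      then show ?case by (intro rtrancl_into_rtrancl[OF step.IH]) (auto simp: R_def)
    qed simp
    have "sym ((R \<inter> {k0..} \<times> {k0..})\<^sup>*)" by (intro sym_rtrancl) (auto simp: sym_def R_def)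
    then show ?thesis unfolding con_def using up by (meson atLeast_iff rtrancl_trans symD)
  qed
  then have "con adj (\<Union>k\<in>{k0..}. U k)"
    using neU join conU by (intro con_UN[of R]) (auto simp: R_def Un_commute)
  then show "con adj S" unfolding S_def U_def .
  \<comment> \<open>The corner box \<open>(6, 6)\<close> of level \<open>k\<close> has a nonempty
    core, whose cells have first coordinate at least \<open>6 * 7 ^ k\<close>.\<close>
  show "infinite S"
  proof
    assume "finite S"
    then have "finite (fst ` S)" by simp
    then have "bdd_above (fst ` S)" by simp
    then obtain M where M: "\<And>z. z \<in> S \<Longrightarrow> fst z \<le> M" unfolding bdd_above_def by blast
    define k where "k = max k0 (nat M)"
    have k: "k0 \<le> k" "M \<le> int k" by (auto simp: k_def)
    have p6: "par (6, 6) = (0, 0)" by (simp add: par_def)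
    obtain z where z: "z \<in> core e (D k) k (6, 6)" using core_nonempty[OF good[OF k(1) p6]] by auto
    then have "z \<in> S" unfolding S_def using k(1) p6 by blast
    have "fst z div 7 ^ k = 6" using core_anc[OF z] by (simp add: anc_def)
    then have "fst z \<ge> 6 * 7 ^ k" by (metis div_mult_mod_eq le_add_same_cancel1 pos_mod_sign zero_less_numeral zero_less_power)
    moreover have "int k < 7 ^ k"
      using of_nat_less_two_power[of k, where 'a = int] power_mono[of "2::int" 7 k] by linarith
    ultimately show False using M[OF \<open>z \<in> S\<close>] k(2) by linarith
  qed
qed

section \<open>Certificates of bad boxes\<close>

text \<open>A certificate is a tree of reasons for a box being bad: empty cells and crowded regions
  at the leaves, two far bad sub-boxes at each node. Probabilities are estimated by a union bound
  over certificates.\<close>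

datatype cert = Emp cell | Disc nat cell | Both cert cert

fun emps :: "cert \<Rightarrow> cell list" where
  "emps (Emp x) = [x]"
| "emps (Disc j x) = []"
| "emps (Both c d) = emps c @ emps d"

fun discs :: "cert \<Rightarrow> (nat \<times> cell) list" where
  "discs (Emp x) = []"
| "discs (Disc j x) = [(j, x)]"
| "discs (Both c d) = discs c @ discs d"

fun occ :: "(cell \<Rightarrow> bool) \<Rightarrow> (nat \<Rightarrow> cell \<Rightarrow> bool) \<Rightarrow> cert \<Rightarrow> bool" where
  "occ e D (Emp x) \<longleftrightarrow> e x"
| "occ e D (Disc j x) \<longleftrightarrow> D j x"
| "occ e D (Both c d) \<longleftrightarrow> occ e D c \<and> occ e D d"

lemma occ_iff: "occ e D c \<longleftrightarrow> (\<forall>x\<in>set (emps c). e x) \<and> (\<forall>(j, x)\<in>set (discs c). D j x)"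
  by (induction c) (simp_all add: ball_Un, blast)

definition far_children :: "cell \<Rightarrow> (cell \<times> cell) set" where
  "far_children x = {(y, y'). par y = x \<and> par y' = x \<and> far y y'}"

fun certs :: "nat \<Rightarrow> cell \<Rightarrow> cert set" where
  "certs 0 x = {Emp x, Disc 0 x}"
| "certs (Suc k) x = insert (Disc (Suc k) x)
     (\<Union>(y, y')\<in>far_children x. (\<lambda>(c, d). Both c d) ` (certs k y \<times> certs k y'))"

lemma children_eq: "{y. par y = x} = {7 * fst x..7 * fst x + 6} \<times> {7 * snd x..7 * snd x + 6}"
  by (rule set_eqI) (simp add: par_eq mem_Times_iff)

lemma finite_children: "finite {y. par y = x}" and card_children: "card {y. par y = x} = 49"
  by (simp_all add: children_eq card_cartesian_product)

lemma finite_far_children: "finite (far_children x)"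
  and card_far_children: "card (far_children x) \<le> 2401"
proof -
  have sub: "far_children x \<subseteq> {y. par y = x} \<times> {y. par y = x}" by (auto simp: far_children_def)
  then show "finite (far_children x)" using finite_children by (meson finite_SigmaI finite_subset)
  have "card (far_children x) \<le> card ({y. par y = x} \<times> {y. par y = x})"
    using sub finite_children by (intro card_mono) auto
  then show "card (far_children x) \<le> 2401" by (simp add: card_cartesian_product card_children)
qed

lemma finite_certs: "finite (certs k x)"
proof (induction k arbitrary: x)
  case (Suc k)
  then show ?case by (auto simp: finite_far_children)
qed simp

lemma bad_imp_cert: "bad e D k x \<Longrightarrow> \<exists>c\<in>certs k x. occ e D c"
proof (induction k arbitrary: x)
  case (Suc k)
  show ?case
  proof (cases "D (Suc k) x")
    case False
    with Suc.prems obtain y y' where "par y = x" "par y' = x" "far y y'" "bad e D k y" "bad e D k y'"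
      by (auto simp: clustered_def)
    moreover from this obtain c d where "c \<in> certs k y" "occ e D c" "d \<in> certs k y'" "occ e D d"
      using Suc.IH by blast
    ultimately have "(y, y') \<in> far_children x" "Both c d \<in> (\<lambda>(c, d). Both c d) ` (certs k y \<times> certs k y')"
      "occ e D (Both c d)"
      by (auto simp: far_children_def)
    then show ?thesis unfolding certs.simps by blast
  qed auto
qed auto

text \<open>The eight neighbouring boxes are included because an interferer just across the border
  of a box may be arbitrarily close to a point inside; outside the region the distance is at least
  one box side.\<close>

definition region :: "nat \<Rightarrow> cell \<Rightarrow> cell set" where
  "region j x = {z. near (anc j z) x}"

lemma region_Suc: "region k y \<subseteq> region (Suc k) (par y)"
  by (auto simp: region_def anc_Suc near_par)

lemma region_far: "far y y' \<Longrightarrow> region k y \<inter> region k y' = {}"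
  by (auto simp: region_def far_def near_def)

text \<open>The two branches of a node live in the regions of two far sub-boxes, which are disjoint,
  and the cells of the two branches have different ancestors. Stating disjointness by list position
  through \<open>sorted_wrt\<close> matches the indexed family in the \<alpha>-condition.\<close>

lemma certs_region:
  assumes "c \<in> certs k x"
  shows "distinct (emps c) \<and> (\<forall>z\<in>set (emps c). anc k z = x) \<and>
    sorted_wrt (\<lambda>(i, u) (j, v). region i u \<inter> region j v = {}) (discs c) \<and>
    (\<forall>(i, u)\<in>set (discs c). region i u \<subseteq> region k x)"
  using assms
proof (induction k arbitrary: x c)
  case (Suc k)
  show ?case
  proof (cases "c = Disc (Suc k) x")
    case False
    then obtain y y' a b where y: "par y = x" "par y' = x" "far y y'"
      and ab: "a \<in> certs k y" "b \<in> certs k y'" and c: "c = Both a b"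
      using Suc.prems by (auto simp: far_children_def)
    note IHa = Suc.IH[OF ab(1)] and IHb = Suc.IH[OF ab(2)]
    have ne: "y \<noteq> y'" using y(3) by (auto simp: far_def)
    have ra: "region i u \<subseteq> region k y" if "(i, u) \<in> set (discs a)" for i u using IHa that by auto
    have rb: "region i u \<subseteq> region k y'" if "(i, u) \<in> set (discs b)" for i u using IHb that by auto
    have "region i u \<inter> region j v = {}" if "(i, u) \<in> set (discs a)" "(j, v) \<in> set (discs b)" for i u j v
      using ra[OF that(1)] rb[OF that(2)] region_far[OF y(3), of k] by blast
    then have "sorted_wrt (\<lambda>(i, u) (j, v). region i u \<inter> region j v = {}) (discs c)"
      using IHa IHb unfolding c discs.simps sorted_wrt_append by fast
    moreover have "region i u \<subseteq> region (Suc k) x" if iu: "(i, u) \<in> set (discs c)" for i u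
    proof -
      consider "(i, u) \<in> set (discs a)" | "(i, u) \<in> set (discs b)"
        using iu unfolding c discs.simps set_append by blast
      then show ?thesis
        using ra rb region_Suc[of k y, unfolded y(1)] region_Suc[of k y', unfolded y(2)] by cases (metis subset_trans)+
    qed
    then have "\<forall>(i, u)\<in>set (discs c). region i u \<subseteq> region (Suc k) x" by fast
    moreover have "\<forall>z\<in>set (emps c). anc (Suc k) z = x"
      using IHa IHb y(1,2) by (simp add: c anc_Suc ball_Un)
    moreover have "anc k z = y" if "z \<in> set (emps a)" for z using IHa that by blast
    then have "set (emps a) \<inter> set (emps b) = {}" using IHb ne by fastforce
    then have "distinct (emps c)" using IHa IHb by (simp add: c)
    ultimately show ?thesis by blast
  qed auto
qed auto

text \<open>Here \<open>r\<close> and \<open>\<delta> j\<close> stand for square roots of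
  probability bounds. The product over the leaves is thus the geometric mean of the bound from the
  empty cells and the bound from the crowded regions, see \<open>cert_weight_sq\<close>.\<close>

fun cert_weight :: "real \<Rightarrow> (nat \<Rightarrow> real) \<Rightarrow> cert \<Rightarrow> real" where
  "cert_weight r \<delta> (Emp x) = r"
| "cert_weight r \<delta> (Disc j x) = \<delta> j"
| "cert_weight r \<delta> (Both c d) = cert_weight r \<delta> c * cert_weight r \<delta> d"

text \<open>A tree of disc events only keeps the full product \<open>\<Prod>\<delta>\<^sup>2\<close> in \<open>cert_bound\<close>: passing to square
  roots there would destroy summability over the levels. In the other trees the loss is harmless.\<close>

fun cert_bound :: "real \<Rightarrow> (nat \<Rightarrow> real) \<Rightarrow> cert \<Rightarrow> real" where
  "cert_bound r \<delta> (Emp x) = r"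
| "cert_bound r \<delta> (Disc j x) = (\<delta> j)\<^sup>2"
| "cert_bound r \<delta> (Both c d) =
     cert_bound r \<delta> c * cert_weight r \<delta> d + cert_weight r \<delta> c * cert_bound r \<delta> d"

lemma sum_UN_le:
  fixes f :: "'b \<Rightarrow> real"
  assumes "finite I" "\<And>i. i \<in> I \<Longrightarrow> finite (F i)" "\<And>x. 0 \<le> f x"
  shows "sum f (\<Union>i\<in>I. F i) \<le> (\<Sum>i\<in>I. sum f (F i))"
  using assms(1,2)
proof (induction rule: finite_induct)
  case (insert i I)
  have "sum f (F i \<union> (\<Union>i\<in>I. F i)) + sum f (F i \<inter> (\<Union>i\<in>I. F i)) = sum f (F i) + sum f (\<Union>i\<in>I. F i)"
    using insert by (intro sum.union_inter) auto
  moreover have "0 \<le> sum f (F i \<inter> (\<Union>i\<in>I. F i))" by (intro sum_nonneg assms(3))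
  ultimately show ?case using insert by simp
qed simp

definition disc_prod :: "(nat \<Rightarrow> real) \<Rightarrow> cert \<Rightarrow> real" where
  "disc_prod \<delta> c = (\<Prod>(j, x)\<leftarrow>discs c. (\<delta> j)\<^sup>2)"

context
  fixes r :: real and \<delta> :: "nat \<Rightarrow> real"
  assumes r: "0 \<le> r" "r \<le> 1" and \<delta>: "\<And>j. 0 \<le> \<delta> j" "\<And>j. \<delta> j \<le> 1"
begin

lemma disc_prod_nonneg: "0 \<le> disc_prod \<delta> c"
  by (induction c) (auto simp: disc_prod_def)

lemma cert_weight_bounds: "0 \<le> cert_weight r \<delta> c" "cert_weight r \<delta> c \<le> 1"
  by (induction c) (auto simp: r \<delta> intro!: mult_le_one)

lemma cert_bound_nonneg: "0 \<le> cert_bound r \<delta> c"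
  by (induction c) (auto simp: r cert_weight_bounds)

lemma cert_weight_sq: "(cert_weight r \<delta> c)\<^sup>2 = (r\<^sup>2) ^ length (emps c) * disc_prod \<delta> c"
  by (induction c) (auto simp: disc_prod_def power_add power_mult_distrib)

text \<open>At a node one of the two factors is weakened from the square of a weight to the weight
  itself, which is at most 1; the other keeps its full product by induction.\<close>

lemma cert_bound_pure: "emps c = [] \<Longrightarrow> disc_prod \<delta> c \<le> cert_bound r \<delta> c"
proof (induction c)
  case (Both c d)
  then have "disc_prod \<delta> d = (cert_weight r \<delta> d)\<^sup>2" using cert_weight_sq[of d] by simp
  also have "\<dots> \<le> cert_weight r \<delta> d" using cert_weight_bounds[of d] by (simp add: power2_eq_square mult_left_le)
  finally have "disc_prod \<delta> c * disc_prod \<delta> d \<le> cert_bound r \<delta> c * cert_weight r \<delta> d"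
    using Both by (intro mult_mono cert_bound_nonneg disc_prod_nonneg) auto
  moreover have "0 \<le> cert_weight r \<delta> c * cert_bound r \<delta> d"
    by (simp add: cert_weight_bounds cert_bound_nonneg)
  ultimately show ?case by (simp add: disc_prod_def)
qed (auto simp: disc_prod_def)

text \<open>The induction follows a branch that contains an empty cell, down to a leaf
  \<open>Emp\<close>, where weight and bound are both \<open>r\<close>. The other summand at each
  node is nonnegative.\<close>

lemma cert_bound_mixed: "emps c \<noteq> [] \<Longrightarrow> cert_weight r \<delta> c \<le> cert_bound r \<delta> c"
proof (induction c)
  case (Both c d)
  have nn: "0 \<le> cert_bound r \<delta> c * cert_weight r \<delta> d" "0 \<le> cert_weight r \<delta> c * cert_bound r \<delta> d"
    by (simp_all add: cert_weight_bounds cert_bound_nonneg)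
  show ?case
  proof (cases "emps c = []")
    case False
    then have "cert_weight r \<delta> c * cert_weight r \<delta> d \<le> cert_bound r \<delta> c * cert_weight r \<delta> d"
      using Both by (intro mult_right_mono) (auto simp: cert_weight_bounds)
    then show ?thesis using nn by simp
  next
    case True
    then have "cert_weight r \<delta> c * cert_weight r \<delta> d \<le> cert_weight r \<delta> c * cert_bound r \<delta> d"
      using Both by (intro mult_left_mono) (auto simp: cert_weight_bounds)
    then show ?thesis using nn by simp
  qed
qed auto

text \<open>A number below both bounds is below their geometric mean. This replaces independence of
  the two processes.\<close>

lemma le_cert_bound:
  assumes "0 \<le> p" "p \<le> (r\<^sup>2) ^ length (emps c)" "p \<le> disc_prod \<delta> c"
  shows "p \<le> cert_bound r \<delta> c"
proof (cases "emps c = []")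
  case True
  then show ?thesis using assms cert_bound_pure by force
next
  case False
  have "p\<^sup>2 \<le> (r\<^sup>2) ^ length (emps c) * disc_prod \<delta> c"
    unfolding power2_eq_square[of p] using assms by (intro mult_mono) auto
  then have "p \<le> cert_weight r \<delta> c"
    unfolding cert_weight_sq[symmetric] using cert_weight_bounds(1) by (rule power2_le_imp_le)
  then show ?thesis using cert_bound_mixed[OF False] by simp
qed

section \<open>Sums over all certificates of a box\<close>

lemma sum_certs_Suc:
  fixes f :: "cert \<Rightarrow> real"
  assumes "\<And>c. 0 \<le> f c"
  shows "(\<Sum>c\<in>certs (Suc k) x. f c) \<le>
    f (Disc (Suc k) x) + (\<Sum>(y, y')\<in>far_children x. \<Sum>c\<in>certs k y. \<Sum>d\<in>certs k y'. f (Both c d))"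
proof -
  let ?B = "\<Union>(y, y')\<in>far_children x. (\<lambda>(c, d). Both c d) ` (certs k y \<times> certs k y')"
  have "Disc (Suc k) x \<notin> ?B" by auto
  then have "(\<Sum>c\<in>certs (Suc k) x. f c) = f (Disc (Suc k) x) + sum f ?B"
    using finite_certs[of "Suc k" x] by (simp add: finite_far_children)
  also have "sum f ?B \<le> (\<Sum>p\<in>far_children x. sum f (case p of (y, y') \<Rightarrow> (\<lambda>(c, d). Both c d) ` (certs k y \<times> certs k y')))"
  proof (rule sum_UN_le[OF finite_far_children])
    show "0 \<le> f c" for c by (rule assms)
    fix p
    show "finite (case p of (y, y') \<Rightarrow> (\<lambda>(c, d). Both c d) ` (certs k y \<times> certs k y'))"
      by (cases p) (simp add: finite_certs)
  qed
  also have "\<dots> = (\<Sum>(y, y')\<in>far_children x. \<Sum>c\<in>certs k y. \<Sum>d\<in>certs k y'. f (Both c d))"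
  proof (intro sum.cong refl, clarify)
    fix y1 y2 y1' y2' :: int
    have "inj_on (\<lambda>(c, d). Both c d) (certs k (y1, y2) \<times> certs k (y1', y2'))" by (simp add: inj_on_def)
    then show "sum f ((\<lambda>(c, d). Both c d) ` (certs k (y1, y2) \<times> certs k (y1', y2')))
        = (\<Sum>c\<in>certs k (y1, y2). \<Sum>d\<in>certs k (y1', y2'). f (Both c d))"
      by (simp add: sum.reindex sum.cartesian_product case_prod_unfold)
  qed
  finally show ?thesis by simp
qed

text \<open>The value \<open>t = 1 / 40000\<close> is preserved by the recursion
  \<open>\<delta> + 2401 * t\<^sup>2\<close>, where \<open>2401 = 49\<^sup>2\<close> bounds the
  number of pairs of sub-boxes; at level 0 it exceeds \<open>r + \<delta> 0\<close>.\<close>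

lemma sum_cert_weight:
  assumes "r \<le> 1 / 80000" "\<And>j. \<delta> j \<le> 1 / 160000"
  shows "(\<Sum>c\<in>certs k x. cert_weight r \<delta> c) \<le> 1 / 40000"
proof (induction k arbitrary: x)
  case 0
  show ?case using assms(1) assms(2)[of 0] by simp
next
  case (Suc k)
  have "(\<Sum>c\<in>certs (Suc k) x. cert_weight r \<delta> c) \<le> \<delta> (Suc k) +
     (\<Sum>(y, y')\<in>far_children x. \<Sum>c\<in>certs k y. \<Sum>d\<in>certs k y'. cert_weight r \<delta> c * cert_weight r \<delta> d)"
    using sum_certs_Suc[of "cert_weight r \<delta>" k x] cert_weight_bounds by simp
  also have "(\<Sum>(y, y')\<in>far_children x. \<Sum>c\<in>certs k y. \<Sum>d\<in>certs k y'. cert_weight r \<delta> c * cert_weight r \<delta> d)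
     \<le> of_nat (card (far_children x)) * (1 / 40000 * (1 / 40000))"
  proof (intro sum_bounded_above, clarify)
    fix y1 y2 y1' y2' :: int
    have "(\<Sum>c\<in>certs k (y1, y2). \<Sum>d\<in>certs k (y1', y2'). cert_weight r \<delta> c * cert_weight r \<delta> d)
      = (\<Sum>c\<in>certs k (y1, y2). cert_weight r \<delta> c) * (\<Sum>d\<in>certs k (y1', y2'). cert_weight r \<delta> d)"
      by (simp add: sum_product)
    also have "\<dots> \<le> 1 / 40000 * (1 / 40000)"
      using Suc by (intro mult_mono sum_nonneg) (auto simp: cert_weight_bounds)
    finally show "(\<Sum>c\<in>certs k (y1, y2). \<Sum>d\<in>certs k (y1', y2'). cert_weight r \<delta> c * cert_weight r \<delta> d)
      \<le> 1 / 40000 * (1 / 40000)" .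
  qed
  also have "\<dots> \<le> 2401 * (1 / 40000 * (1 / 40000))"
    using card_far_children[of x] by (intro mult_right_mono) auto
  finally show ?case using assms(2)[of "Suc k"] by simp
qed

text \<open>Since \<open>cert_bound\<close> obeys a product rule, its sum over pairs of certificates
  is linear in the sum \<open>v\<close> of the previous level, with the small sum of weights as
  coefficient. Unrolling the recursion gives the geometric convolution.\<close>

lemma sum_cert_bound:
  assumes "r \<le> 1 / 80000" "\<And>j. \<delta> j \<le> 1 / 160000"
  shows "(\<Sum>c\<in>certs k x. cert_bound r \<delta> c) \<le> (1 / 8) ^ k * r + (\<Sum>j\<le>k. (1 / 8) ^ (k - j) * (\<delta> j)\<^sup>2)"
proof (induction k arbitrary: x)
  case 0
  show ?case by simp
next
  case (Suc k)
  define v where "v = (1 / 8) ^ k * r + (\<Sum>j\<le>k. (1 / 8) ^ (k - j) * (\<delta> j)\<^sup>2)"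
  have v: "0 \<le> v" unfolding v_def using r by (intro add_nonneg_nonneg sum_nonneg) auto
  note t = sum_cert_weight[OF assms]
  have "(\<Sum>c\<in>certs (Suc k) x. cert_bound r \<delta> c) \<le> (\<delta> (Suc k))\<^sup>2 +
     (\<Sum>(y, y')\<in>far_children x. \<Sum>c\<in>certs k y. \<Sum>d\<in>certs k y'. cert_bound r \<delta> (Both c d))"
    using sum_certs_Suc[of "cert_bound r \<delta>" k x] cert_bound_nonneg by simp
  also have "(\<Sum>(y, y')\<in>far_children x. \<Sum>c\<in>certs k y. \<Sum>d\<in>certs k y'. cert_bound r \<delta> (Both c d))
     \<le> of_nat (card (far_children x)) * (2 * (v * (1 / 40000)))"
  proof (intro sum_bounded_above, clarify)
    fix y1 y2 y1' y2' :: int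
    let ?y = "(y1, y2)" and ?y' = "(y1', y2')"
    have "(\<Sum>c\<in>certs k ?y. \<Sum>d\<in>certs k ?y'. cert_bound r \<delta> (Both c d))
      = (\<Sum>c\<in>certs k ?y. cert_bound r \<delta> c) * (\<Sum>d\<in>certs k ?y'. cert_weight r \<delta> d)
        + (\<Sum>c\<in>certs k ?y. cert_weight r \<delta> c) * (\<Sum>d\<in>certs k ?y'. cert_bound r \<delta> d)"
      by (simp add: sum_product sum.distrib)
    also have "\<dots> \<le> v * (1 / 40000) + 1 / 40000 * v"
      using Suc t v unfolding v_def[symmetric]
      by (intro add_mono mult_mono sum_nonneg) (auto simp: cert_weight_bounds cert_bound_nonneg)
    finally show "(\<Sum>c\<in>certs k ?y. \<Sum>d\<in>certs k ?y'. cert_bound r \<delta> (Both c d)) \<le> 2 * (v * (1 / 40000))"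
      by simp
  qed
  also have "\<dots> \<le> 2401 * (2 * (v * (1 / 40000)))"
    using card_far_children[of x] v by (intro mult_right_mono) auto
  \<comment> \<open>\<open>2 * 2401 / 40000\<close> is about 0.12, just below 1/8.\<close>
  also have "\<dots> \<le> v / 8" using v by simp
  also have "(\<delta> (Suc k))\<^sup>2 + v / 8 = (1 / 8) ^ Suc k * r + (\<Sum>j\<le>Suc k. (1 / 8) ^ (Suc k - j) * (\<delta> j)\<^sup>2)"
    by (simp add: v_def sum_distrib_left sum_divide_distrib Suc_diff_le add_divide_distrib)
  finally show ?case by simp
qed

end

section \<open>Boxes in the plane and the point processes\<close>

definition cell_of :: "real \<Rightarrow> real^2 \<Rightarrow> cell" where
  "cell_of s p = (\<lfloor>p $ 1 / s\<rfloor>, \<lfloor>p $ 2 / s\<rfloor>)"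

definition rect :: "real \<Rightarrow> real \<Rightarrow> real \<Rightarrow> real \<Rightarrow> (real^2) set" where
  "rect a b c d = {p. a \<le> p $ 1 \<and> p $ 1 < b \<and> c \<le> p $ 2 \<and> p $ 2 < d}"

lemma rect_borel [measurable]: "rect a b c d \<in> sets borel"
  unfolding rect_def by measurable

lemma rect_subset_cbox: "rect a b c d \<subseteq> cbox (vector [a, c]) (vector [b, d])"
  by (auto simp: rect_def mem_box_cart forall_2)

lemma box_subset_rect: "box (vector [a, c]) (vector [b, d]) \<subseteq> rect a b c d"
  by (auto simp: rect_def mem_box_cart forall_2)

lemma bounded_rect: "bounded (rect a b c d)"
  using bounded_subset[OF bounded_cbox rect_subset_cbox] .

text \<open>The half-open rectangle lies between the open and the closed box, which have equal
  volume.\<close>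

lemma emeasure_rect:
  assumes "a \<le> b" "c \<le> d"
  shows "emeasure lborel (rect a b c d) = ennreal ((b - a) * (d - c))"
proof -
  let ?l = "vector [a, c] :: real^2" and ?u = "vector [b, d] :: real^2"
  have "?l \<in> cbox ?l ?u" using assms by (simp add: mem_box_cart forall_2)
  then have ne: "cbox ?l ?u \<noteq> {}" by blast
  have cb: "emeasure lborel (cbox ?l ?u) = ennreal ((b - a) * (d - c))"
    using content_cbox_cart[OF ne] emeasure_lborel_cbox_finite[of ?l ?u]
    by (simp add: emeasure_eq_ennreal_measure UNIV_2)
  have "emeasure lborel (box ?l ?u) = emeasure lborel (cbox ?l ?u)"
    by (simp add: emeasure_lborel_box_eq emeasure_lborel_cbox_eq)
  then show ?thesis
    using cb emeasure_mono[OF rect_subset_cbox[of a b c d], of lborel]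
      emeasure_mono[OF box_subset_rect[of a c b d], of lborel] by simp
qed

lemma cell_of_eq:
  assumes "0 < s"
  shows "cell_of s -` {z} = rect (s * fst z) (s * (fst z + 1)) (s * snd z) (s * (snd z + 1))"
proof -
  have "\<lfloor>a / s\<rfloor> = i \<longleftrightarrow> s * of_int i \<le> a \<and> a < s * (of_int i + 1)" for a i
    unfolding floor_eq_iff pos_le_divide_eq[OF assms] pos_divide_less_eq[OF assms]
    by (simp only: mult.commute)
  then show ?thesis by (simp add: set_eq_iff cell_of_def rect_def prod_eq_iff)
qed

lemma cell_of_vimage_borel [measurable]:
  assumes "0 < s"
  shows "cell_of s -` Z \<in> sets borel"
proof -
  have "cell_of s -` Z = (\<Union>z\<in>Z. cell_of s -` {z})" by auto
  also have "\<dots> \<in> sets borel"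
    using cell_of_eq[OF assms] by (intro sets.countable_UN') auto
  finally show ?thesis .
qed

text \<open>Integer division of cell indices corresponds to enlarging the mesh, so the boxes of
  level \<open>j\<close> are genuine squares of side \<open>s * 7 ^ j\<close>.\<close>

lemma floor_scaled:
  fixes a s :: real
  assumes "0 < s"
  shows "\<lfloor>a / s\<rfloor> div 7 ^ j = \<lfloor>a / (s * 7 ^ j)\<rfloor>"
  using floor_divide_real_eq_div[of "7 ^ j" "a / s"] by (simp add: divide_divide_eq_left)

lemma region_vimage:
  assumes s: "0 < s"
  shows "cell_of s -` region j x =
    rect (s * 7 ^ j * (fst x - 1)) (s * 7 ^ j * (fst x + 2)) (s * 7 ^ j * (snd x - 1)) (s * 7 ^ j * (snd x + 2))"
proof -
  have "\<bar>\<lfloor>a / (s * 7 ^ j)\<rfloor> - i\<bar> \<le> 1 \<longleftrightarrow> s * 7 ^ j * (real_of_int i - 1) \<le> a \<and> a < s * 7 ^ j * (real_of_int i + 2)"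
    for a :: real and i :: int
  proof -
    have pos: "0 < s * 7 ^ j" using s by simp
    have "\<bar>\<lfloor>a / (s * 7 ^ j)\<rfloor> - i\<bar> \<le> 1 \<longleftrightarrow> i - 1 \<le> \<lfloor>a / (s * 7 ^ j)\<rfloor> \<and> \<lfloor>a / (s * 7 ^ j)\<rfloor> < i + 2" by auto
    also have "\<dots> \<longleftrightarrow> real_of_int i - 1 \<le> a / (s * 7 ^ j) \<and> a / (s * 7 ^ j) < real_of_int i + 2"
      unfolding le_floor_iff floor_less_iff by simp
    finally show ?thesis
      by (simp only: pos_le_divide_eq[OF pos] pos_divide_less_eq[OF pos] mult.commute[of _ "s * 7 ^ j"])
  qed
  then show ?thesis
    by (auto simp: region_def near_def anc_def cell_of_def rect_def floor_scaled[OF s])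
qed

lemma emeasure_region:
  assumes "0 < s"
  shows "emeasure lborel (cell_of s -` region j x) = ennreal (9 * (s * 7 ^ j)\<^sup>2)"
proof -
  have "emeasure lborel (rect (t * (u - 1)) (t * (u + 2)) (t * (v - 1)) (t * (v + 2))) = ennreal (9 * t\<^sup>2)"
    if "0 < t" for t u v :: real
  proof -
    have "(t * (u + 2) - t * (u - 1)) * (t * (v + 2) - t * (v - 1)) = 9 * t\<^sup>2"
      by (simp add: algebra_simps power2_eq_square)
    then show ?thesis using that by (subst emeasure_rect) simp_all
  qed
  then show ?thesis using assms unfolding region_vimage[OF assms] by simp
qed

lemma bounded_region: "0 < s \<Longrightarrow> bounded (cell_of s -` region j x)"
  by (simp add: region_vimage bounded_rect)

lemma emeasure_cells:
  assumes "0 < s" "finite Z"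
  shows "emeasure lborel (cell_of s -` Z) = ennreal (s\<^sup>2 * card Z)"
proof -
  have "cell_of s -` Z = (\<Union>z\<in>Z. cell_of s -` {z})" by auto
  then have "emeasure lborel (cell_of s -` Z) = (\<Sum>z\<in>Z. emeasure lborel (cell_of s -` {z}))"
    using assms cell_of_vimage_borel[OF assms(1)]
    by (simp only:, intro sum_emeasure[symmetric]) (auto simp: disjoint_family_on_def)
  also have "\<dots> = (\<Sum>z\<in>Z. ennreal (s\<^sup>2))"
  proof (rule sum.cong[OF refl])
    fix z
    have "(s * (u + 1) - s * u) * (s * (v + 1) - s * v) = s\<^sup>2" for u v :: real
      by (simp add: algebra_simps power2_eq_square)
    then show "emeasure lborel (cell_of s -` {z}) = ennreal (s\<^sup>2)"
      unfolding cell_of_eq[OF assms(1)] using assms(1) by (subst emeasure_rect) simp_all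
  qed
  finally show ?thesis by (simp add: ennreal_mult' ennreal_of_nat_eq_real_of_nat mult.commute)
qed

lemma bounded_cells:
  assumes "0 < s" "finite Z"
  shows "bounded (cell_of s -` Z)"
proof -
  have "cell_of s -` Z = (\<Union>z\<in>Z. cell_of s -` {z})" by auto
  also have "bounded \<dots>" using assms by (simp only: cell_of_eq[OF assms(1)]) (intro bounded_UN, auto simp: bounded_rect)
  finally show ?thesis .
qed

section \<open>Counts, void probabilities and atoms of point processes\<close>

lemma space_counting_measure_algebra: "space counting_measure_algebra = radon_counting_measures"
  unfolding counting_measure_algebra_def by (rule space_measure_of) auto

lemma point_process_radon: "point_process M \<Phi> \<Longrightarrow> \<omega> \<in> space M \<Longrightarrow> \<Phi> \<omega> \<in> radon_counting_measures"
  unfolding point_process_def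
  using measurable_space[of \<Phi> M counting_measure_algebra \<omega>] by (simp add: space_counting_measure_algebra)

lemma point_process_count_measurable:
  assumes "point_process M \<Phi>" "B \<in> sets borel" "bounded B"
  shows "(\<lambda>\<omega>. emeasure (\<Phi> \<omega>) B) \<in> borel_measurable M"
proof (rule measurableI)
  fix A :: "ennreal set" assume A: "A \<in> sets borel"
  have "{m \<in> radon_counting_measures. emeasure m B \<in> A} \<in> sets counting_measure_algebra"
    unfolding counting_measure_algebra_def using A assms by (intro in_measure_of) auto
  from measurable_sets[OF assms(1)[unfolded point_process_def] this]
  show "(\<lambda>\<omega>. emeasure (\<Phi> \<omega>) B) -` A \<inter> space M \<in> sets M"
    using point_process_radon[OF assms(1)] by (auto elim!: back_subst[of "\<lambda>X. X \<in> sets M"])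
qed simp

text \<open>Several cells are empty exactly if their union is. The \<nu>-condition is applied to
  this union, and additivity of area turns the exponential into a product over the cells.\<close>

lemma prob_empty_cells:
  assumes "prob_space M" "point_process M \<Phi>" "nu_weakly_sub_poisson M \<Phi>" "has_intensity M \<Phi> c" "0 < c"
    and "0 < s" "finite Z"
  shows "measure M {\<omega> \<in> space M. \<forall>z\<in>Z. emeasure (\<Phi> \<omega>) (cell_of s -` {z}) = 0} \<le> exp (- (c * s\<^sup>2)) ^ card Z"
proof -
  interpret prob_space M by fact
  let ?U = "cell_of s -` Z"
  have U: "?U \<in> sets borel" "bounded ?U" using cell_of_vimage_borel bounded_cells assms(6,7) by auto
  have mean: "mean_count M \<Phi> ?U = ennreal (c * s\<^sup>2 * card Z)"
    using assms(4,5) U(1) unfolding has_intensity_def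
    by (simp add: emeasure_cells[OF assms(6,7)] ennreal_mult[symmetric] mult.assoc)
  have "{\<omega> \<in> space M. \<forall>z\<in>Z. emeasure (\<Phi> \<omega>) (cell_of s -` {z}) = 0} = {\<omega> \<in> space M. emeasure (\<Phi> \<omega>) ?U = 0}"
  proof (intro Collect_cong conj_cong refl)
    fix \<omega> assume "\<omega> \<in> space M"
    then have sets: "sets (\<Phi> \<omega>) = sets borel"
      using point_process_radon[OF assms(2)] by (auto simp: radon_counting_measures_def)
    have Un: "?U = (\<Union>z\<in>Z. cell_of s -` {z})" by auto
    have "emeasure (\<Phi> \<omega>) ?U = (\<Sum>z\<in>Z. emeasure (\<Phi> \<omega>) (cell_of s -` {z}))"
      unfolding Un using assms(7) cell_of_vimage_borel[OF assms(6)] sets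
      by (intro sum_emeasure[symmetric]) (auto simp: disjoint_family_on_def)
    then show "(\<forall>z\<in>Z. emeasure (\<Phi> \<omega>) (cell_of s -` {z}) = 0) \<longleftrightarrow> emeasure (\<Phi> \<omega>) ?U = 0"
      using assms(7) by simp
  qed
  also have "prob \<dots> \<le> exp (- (c * s\<^sup>2 * card Z))"
    using assms(3)[unfolded nu_weakly_sub_poisson_def, rule_format, OF U] assms(5) by (simp add: mean)
  also have "\<dots> = exp (- (c * s\<^sup>2)) ^ card Z"
    by (simp add: exp_of_nat_mult[symmetric] mult.commute mult.left_commute)
  finally show ?thesis .
qed

text \<open>Markov's inequality for a product: on the event every ratio
  \<open>lam j * count / \<tau> j\<close> is at least 1, so the indicator is at most the product of
  these ratios, whose expectation the \<alpha>-condition bounds for disjoint regions. The factor 9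
  comes from the 3 x 3 blocks.\<close>

lemma prob_crowded_regions:
  fixes lam \<tau> :: "nat \<Rightarrow> real" and ds :: "(nat \<times> cell) list"
  assumes "prob_space M" "point_process M \<Phi>" "alpha_weakly_sub_poisson M \<Phi>" "has_intensity M \<Phi> \<mu>" "0 < \<mu>"
    and "0 < s" "\<And>j. 0 < lam j" "\<And>j. 0 < \<tau> j"
    and "sorted_wrt (\<lambda>(i, u) (j, v). region i u \<inter> region j v = {}) ds"
  shows "measure M {\<omega> \<in> space M. \<forall>(j, x)\<in>set ds. ennreal (\<tau> j) < ennreal (lam j) * emeasure (\<Phi> \<omega>) (cell_of s -` region j x)}
    \<le> (\<Prod>(j, x)\<leftarrow>ds. 9 * \<mu> * (lam j * (s * 7 ^ j)\<^sup>2) / \<tau> j)"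
proof (cases "ds = []")
  \<comment> \<open>The \<alpha>-condition speaks of at least one set; for the empty list the bound
    is 1.\<close>
  case True
  then show ?thesis using prob_space.prob_space[OF assms(1)] by simp
next
  case False
  interpret prob_space M by fact
  define n where "n = length ds"
  have n: "1 \<le> n" using False by (cases ds) (auto simp: n_def)
  define J where "J i = fst (ds ! i)" for i
  define B where "B i = cell_of s -` region (J i) (snd (ds ! i))" for i
  let ?A = "{\<omega> \<in> space M. \<forall>i<n. ennreal (\<tau> (J i)) < ennreal (lam (J i)) * emeasure (\<Phi> \<omega>) (B i)}"
  have A_eq: "{\<omega> \<in> space M. \<forall>(j, x)\<in>set ds. ennreal (\<tau> j) < ennreal (lam j) * emeasure (\<Phi> \<omega>) (cell_of s -` region j x)} = ?A"
    by (auto simp: all_set_conv_all_nth n_def J_def B_def case_prod_unfold)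
  have B: "B i \<in> sets borel" "bounded (B i)" for i
    unfolding B_def using cell_of_vimage_borel bounded_region assms(6) by auto
  have [measurable]: "(\<lambda>\<omega>. emeasure (\<Phi> \<omega>) (B i)) \<in> borel_measurable M" for i
    using point_process_count_measurable[OF assms(2) B] .
  have "disjoint_family_on B {..<n}"
  proof -
    have "B i \<inter> B k = {}" if "i < k" "k < n" for i k
      using sorted_wrt_nth_less[OF assms(9), of i k] that by (auto simp: n_def B_def J_def case_prod_unfold)
    then show ?thesis unfolding disjoint_family_on_def
      by (metis Int_commute lessThan_iff linorder_neqE_nat)
  qed
  then have alpha: "(\<integral>\<^sup>+\<omega>. (\<Prod>i<n. emeasure (\<Phi> \<omega>) (B i)) \<partial>M) \<le> (\<Prod>i<n. mean_count M \<Phi> (B i))"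
    using assms(3) n B unfolding alpha_weakly_sub_poisson_def by blast
  have mean: "mean_count M \<Phi> (B i) = ennreal (9 * \<mu> * (s * 7 ^ J i)\<^sup>2)" for i
    using assms(4,5) B(1)[of i] unfolding has_intensity_def B_def
    by (simp add: emeasure_region[OF assms(6)] ennreal_mult[symmetric] mult.assoc mult.left_commute)
  define w where "w i = lam (J i) / \<tau> (J i)" for i
  have w: "0 < w i" for i using assms(7,8) by (simp add: w_def)
  have "emeasure M ?A = (\<integral>\<^sup>+\<omega>. indicator ?A \<omega> \<partial>M)" by simp
  also have "\<dots> \<le> (\<integral>\<^sup>+\<omega>. (\<Prod>i<n. ennreal (w i)) * (\<Prod>i<n. emeasure (\<Phi> \<omega>) (B i)) \<partial>M)"
  proof (rule nn_integral_mono)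
    fix \<omega>
    show "indicator ?A \<omega> \<le> (\<Prod>i<n. ennreal (w i)) * (\<Prod>i<n. emeasure (\<Phi> \<omega>) (B i))"
    proof (cases "\<omega> \<in> ?A")
      case True
      have "1 \<le> ennreal (w i) * emeasure (\<Phi> \<omega>) (B i)" if "i < n" for i
      proof -
        have "ennreal (1 / \<tau> (J i)) * ennreal (\<tau> (J i)) \<le> ennreal (1 / \<tau> (J i)) * (ennreal (lam (J i)) * emeasure (\<Phi> \<omega>) (B i))"
          using True that by (intro mult_left_mono) (auto intro: less_imp_le)
        moreover have "ennreal (1 / \<tau> (J i)) * ennreal (\<tau> (J i)) = 1"
          using assms(8)[of "J i"] by (simp add: ennreal_mult[symmetric])
        moreover have "ennreal (1 / \<tau> (J i)) * ennreal (lam (J i)) = ennreal (w i)"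
          using assms(7,8)[of "J i"] by (simp add: ennreal_mult[symmetric] w_def)
        ultimately show ?thesis by (simp add: mult.assoc[symmetric])
      qed
      then have "1 \<le> (\<Prod>i<n. ennreal (w i) * emeasure (\<Phi> \<omega>) (B i))" by (intro prod_ge_1) auto
      then show ?thesis using True by (simp add: prod.distrib)
    qed simp
  qed
  also have "\<dots> = (\<Prod>i<n. ennreal (w i)) * (\<integral>\<^sup>+\<omega>. (\<Prod>i<n. emeasure (\<Phi> \<omega>) (B i)) \<partial>M)"
    by (intro nn_integral_cmult) measurable
  also have "\<dots> \<le> (\<Prod>i<n. ennreal (w i)) * (\<Prod>i<n. mean_count M \<Phi> (B i))"
    by (intro mult_left_mono alpha) simp
  also have "\<dots> = (\<Prod>i<n. ennreal (w i * (9 * \<mu> * (s * 7 ^ J i)\<^sup>2)))"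
    using w assms(5) by (simp add: mean prod.distrib[symmetric] ennreal_mult[symmetric] less_imp_le)
  also have "\<dots> = ennreal (\<Prod>i<n. w i * (9 * \<mu> * (s * 7 ^ J i)\<^sup>2))"
    using w assms(5) by (intro prod_ennreal) (simp add: less_imp_le)
  finally have le: "emeasure M ?A \<le> ennreal (\<Prod>i<n. w i * (9 * \<mu> * (s * 7 ^ J i)\<^sup>2))" .
  have nn: "0 \<le> (\<Prod>i<n. w i * (9 * \<mu> * (s * 7 ^ J i)\<^sup>2))"
    using w assms(5) by (intro prod_nonneg) (simp add: less_imp_le)
  have "(\<Prod>i<n. w i * (9 * \<mu> * (s * 7 ^ J i)\<^sup>2)) = (\<Prod>(j, x)\<leftarrow>ds. 9 * \<mu> * (lam j * (s * 7 ^ j)\<^sup>2) / \<tau> j)"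
    by (simp add: prod.list_conv_set_nth n_def atLeast0LessThan w_def J_def case_prod_unfold mult.assoc mult.left_commute)
  then show ?thesis unfolding A_eq
    using le nn by (simp add: emeasure_eq_measure)
qed

text \<open>Around a point of measure 0 the counts of shrinking balls tend to 0 and, being integers,
  vanish eventually. If \<open>B\<close> had no atom, compactness of its closure would cover it by
  finitely many null sets.\<close>

lemma counting_measure_atom:
  assumes m: "m \<in> radon_counting_measures" and B: "B \<in> sets borel" "bounded B" and pos: "emeasure m B \<noteq> 0"
  shows "\<exists>x\<in>B. x \<in> points m"
proof (rule ccontr)
  assume no: "\<not> ?thesis"
  have sets [simp]: "sets m = sets borel" using m by (simp add: radon_counting_measures_def)
  have int: "emeasure m A \<in> range (of_nat :: nat \<Rightarrow> ennreal)" if "A \<in> sets borel" "bounded A" for A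
    using m that by (auto simp: radon_counting_measures_def)
  have fin: "emeasure m A \<noteq> \<infinity>" if "A \<in> sets borel" "bounded A" for A
    using int[OF that] by auto
  have loc: "\<exists>U. open U \<and> x \<in> U \<and> emeasure m (B \<inter> U) = 0" for x
  proof -
    define A where "A n = B \<inter> ball x (1 / real (Suc n))" for n
    have A: "A n \<in> sets borel" "bounded (A n)" for n using B by (auto simp: A_def bounded_Int)
    have "decseq A" unfolding A_def decseq_def
      by (intro allI impI Int_mono subset_refl subset_ball) (simp add: frac_le)
    then have "(\<lambda>n. emeasure m (A n)) \<longlonglongrightarrow> emeasure m (\<Inter>n. A n)"
      using A fin by (intro Lim_emeasure_decseq) auto
    moreover have "(\<Inter>n. A n) = B \<inter> {x}"
    proof -
      have "y = x" if y: "\<And>n. dist x y < 1 / real (Suc n)" for y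
      proof (rule ccontr)
        assume "y \<noteq> x"
        then obtain n where "1 / real (Suc n) < dist x y"
          using reals_Archimedean[of "dist x y"] by (auto simp: inverse_eq_divide)
        with y[of n] show False by simp
      qed
      then show ?thesis by (auto simp: A_def)
    qed
    moreover have "emeasure m (B \<inter> {x}) = 0"
      using no by (cases "x \<in> B") (auto simp: points_def)
    ultimately have "(\<lambda>n. emeasure m (A n)) \<longlonglongrightarrow> 0" by simp
    then have "eventually (\<lambda>n. emeasure m (A n) < 1) sequentially"
      by (rule order_tendstoD) simp
    then obtain n where n: "emeasure m (A n) < 1" by (auto simp: eventually_sequentially)
    obtain k :: nat where "emeasure m (A n) = of_nat k" using int[OF A] by auto
    with n have "emeasure m (A n) = 0" by (cases k) auto
    then show ?thesis unfolding A_def by (intro exI[of _ "ball x (1 / real (Suc n))"]) auto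
  qed
  then obtain U where U: "\<And>x. open (U x)" "\<And>x. x \<in> U x" "\<And>x. emeasure m (B \<inter> U x) = 0" by metis
  have "compact (closure B)" using B(2) by (simp add: compact_closure)
  moreover have "closure B \<subseteq> (\<Union>x\<in>closure B. U x)" using U(2) by blast
  ultimately obtain C where C: "C \<subseteq> closure B" "finite C" "closure B \<subseteq> (\<Union>x\<in>C. U x)"
    using compactE_image[of "closure B" "closure B" U] U(1) by metis
  have "B = (\<Union>x\<in>C. B \<inter> U x)" using C(3) closure_subset[of B] by blast
  moreover have "(\<lambda>x. B \<inter> U x) ` C \<subseteq> sets m" using B(1) borel_open[OF U(1)] by auto
  then have "emeasure m (\<Union>x\<in>C. B \<inter> U x) \<le> (\<Sum>x\<in>C. emeasure m (B \<inter> U x))"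
    by (rule emeasure_subadditive_finite[OF C(2)])
  ultimately have "emeasure m B \<le> (\<Sum>x\<in>C. emeasure m (B \<inter> U x))" by metis
  then show False using U(3) pos by simp
qed

section \<open>Path loss and interference\<close>

text \<open>An upper bound for the path loss of an interferer that is near at level \<open>j\<close>
  but not at level \<open>j - 1\<close>, hence at distance at least \<open>s * 7 ^ (j - 1)\<close>;
  at level 0 only \<open>l \<le> 1\<close> is available.\<close>

definition decay :: "(real \<Rightarrow> real) \<Rightarrow> real \<Rightarrow> nat \<Rightarrow> real" where
  "decay l s j = (case j of 0 \<Rightarrow> 1 | Suc i \<Rightarrow> l (s * 7 ^ i))"

lemma decay_simps [simp]: "decay l s 0 = 1" "decay l s (Suc i) = l (s * 7 ^ i)"
  by (simp_all add: decay_def)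

text \<open>Cells on opposite sides of an axis never get a common ancestor, since their quotients
  settle at -1 and 0. These differ by 1 only, which \<open>near\<close> allows.\<close>

lemma near_anc_eventually: "\<exists>j. near (anc j w) (anc j z)"
proof -
  define n where "n = nat (\<bar>fst w\<bar> + \<bar>snd w\<bar> + \<bar>fst z\<bar> + \<bar>snd z\<bar>)"
  have big: "int n < 7 ^ n"
    using of_nat_less_two_power[of n, where 'a = int] power_mono[of "2::int" 7 n] by linarith
  have *: "a div 7 ^ n \<in> {-1, 0}" if "\<bar>a\<bar> < 7 ^ n" for a :: int
  proof (cases "0 \<le> a")
    case True
    then show ?thesis using that by (simp add: div_pos_pos_trivial)
  next
    case False
    then have "a div 7 ^ n = -1"
      using that by (intro int_div_pos_eq[of _ _ _ "a + 7 ^ n"]) auto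
    then show ?thesis by simp
  qed
  have n: "int n = \<bar>fst w\<bar> + \<bar>snd w\<bar> + \<bar>fst z\<bar> + \<bar>snd z\<bar>" by (simp add: n_def)
  have "fst w div 7 ^ n \<in> {-1, 0}" "snd w div 7 ^ n \<in> {-1, 0}"
    "fst z div 7 ^ n \<in> {-1, 0}" "snd z div 7 ^ n \<in> {-1, 0}"
    by (rule *, use n big in linarith)+
  then have "near (anc n w) (anc n z)" by (auto simp: near_def anc_def)
  then show ?thesis by blast
qed

text \<open>Some pair of box indices differs by at least 2, so a whole box side lies between the two
  coordinates.\<close>

lemma dist_outside_region:
  assumes s: "0 < s" and out: "cell_of s w \<notin> region j (anc j (cell_of s y))"
  shows "s * 7 ^ j \<le> norm (w - y)"
proof -
  let ?t = "s * 7 ^ j"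
  have t: "0 < ?t" using s by simp
  have *: "?t \<le> \<bar>a - b\<bar>" if "\<not> \<bar>\<lfloor>a / ?t\<rfloor> - \<lfloor>b / ?t\<rfloor>\<bar> \<le> 1" for a b :: real
  proof -
    have "1 \<le> \<bar>a / ?t - b / ?t\<bar>" using that by linarith
    also have "\<dots> = \<bar>a - b\<bar> / ?t" using t by (simp add: diff_divide_distrib[symmetric] abs_divide abs_of_pos del: zero_less_mult_iff)
    finally show ?thesis using t by (simp add: pos_le_divide_eq[OF t])
  qed
  from out consider "\<not> \<bar>\<lfloor>w $ 1 / ?t\<rfloor> - \<lfloor>y $ 1 / ?t\<rfloor>\<bar> \<le> 1" | "\<not> \<bar>\<lfloor>w $ 2 / ?t\<rfloor> - \<lfloor>y $ 2 / ?t\<rfloor>\<bar> \<le> 1"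
    by (auto simp: region_def near_def anc_def cell_of_def floor_scaled[OF s])
  then show ?thesis
  proof cases
    case 1
    then show ?thesis using *[OF 1] component_le_norm_cart[of "w - y" 1] by simp
  next
    case 2
    then show ?thesis using *[OF 2] component_le_norm_cart[of "w - y" 2] by simp
  qed
qed

lemma norm_adj_cells:
  assumes s: "0 < s" and "(cell_of s x, cell_of s y) \<in> adj"
  shows "norm (x - y) \<le> 4 * s"
proof -
  have *: "\<bar>a - b\<bar> \<le> 2 * s" if "\<bar>\<lfloor>a / s\<rfloor> - \<lfloor>b / s\<rfloor>\<bar> \<le> 1" for a b :: real
  proof -
    have "\<bar>a / s - b / s\<bar> \<le> 2" using that by linarith
    then have "\<bar>a - b\<bar> / s \<le> 2" using s by (simp add: diff_divide_distrib[symmetric] abs_divide abs_of_pos)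
    then show ?thesis using s by (simp add: pos_divide_le_eq)
  qed
  have "norm (x - y) \<le> \<bar>x $ 1 - y $ 1\<bar> + \<bar>x $ 2 - y $ 2\<bar>"
    using norm_le_l1_cart[of "x - y"] by (simp add: UNIV_2)
  also have "\<dots> \<le> 2 * s + 2 * s"
    using assms(2) by (intro add_mono *) (auto simp: adj_def cell_of_def)
  finally show ?thesis by simp
qed

locale path_loss =
  fixes l :: "real \<Rightarrow> real" and s :: real
  assumes cont: "continuous_on {0..} l"
    and decr: "strict_antimono_on {0..} l"
    and pos: "\<And>x. x \<ge> 0 \<Longrightarrow> l x > 0"
    and le1: "\<And>x. x \<ge> 0 \<Longrightarrow> l x \<le> 1"
    and s: "0 < s"
begin

lemma decr': "0 \<le> x \<Longrightarrow> x \<le> y \<Longrightarrow> l y \<le> l x"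
  using monotone_onD[OF decr, of x y] by (cases "x = y") auto

lemma decay_pos: "0 < decay l s j"
  using s by (cases j) (simp_all add: pos)

lemma path_loss_measurable [measurable]: "(\<lambda>w. ennreal (l (norm (w - y)))) \<in> borel_measurable borel"
proof -
  have "continuous_on UNIV (\<lambda>w. l (norm (w - y)))"
    by (rule continuous_on_compose2[OF cont]) (auto intro!: continuous_intros)
  then show ?thesis by (intro measurable_compose[OF borel_measurable_continuous_onI measurable_ennreal])
qed

text \<open>The term of the least level at which \<open>w\<close> is near \<open>y\<close> already
  dominates the path loss.\<close>

lemma path_loss_le_decay:
  "ennreal (l (norm (w - y))) \<le>
    (\<Sum>j. ennreal (decay l s j) * indicator (cell_of s -` region j (anc j (cell_of s y))) w)" 
proof -
  define f where "f j = ennreal (decay l s j) * indicator (cell_of s -` region j (anc j (cell_of s y))) w" for j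
  define P where "P j \<longleftrightarrow> cell_of s w \<in> region j (anc j (cell_of s y))" for j
  have "\<exists>j. P j" unfolding P_def region_def using near_anc_eventually by simp
  then obtain j where j: "P j" "\<And>i. i < j \<Longrightarrow> \<not> P i" using exists_least_iff[of P] by blast
  have "l (norm (w - y)) \<le> decay l s j"
  proof (cases j)
    case 0
    then show ?thesis using le1 by simp
  next
    case (Suc i)
    then have "s * 7 ^ i \<le> norm (w - y)" using j(2)[of i] unfolding P_def by (intro dist_outside_region s) auto
    then show ?thesis using Suc s by (auto intro: decr')
  qed
  then have "ennreal (l (norm (w - y))) \<le> f j" using j(1) by (simp add: P_def f_def ennreal_leI)
  also have "\<dots> \<le> (\<Sum>j. f j)" using sum_le_suminf[of f "{j}"] by simp
  finally show ?thesis unfolding f_def .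
qed

text \<open>Deleting points only lowers the integral. The right side depends on \<open>y\<close>
  through its cell alone, so it controls all receivers in a cell at once.\<close>

lemma interference_le:
  assumes "sets m = sets borel"
  shows "interference l (remove_point x m) y \<le>
    (\<Sum>j. ennreal (decay l s j) * emeasure m (cell_of s -` region j (anc j (cell_of s y))))"
proof -
  note [measurable_cong] = assms
  have "interference l (remove_point x m) y =
      (\<integral>\<^sup>+w. indicator (- {x}) w * (indicator (- {y}) w * ennreal (l (norm (w - y)))) \<partial>m)"
    unfolding interference_def remove_point_def
    by (simp add: nn_integral_density)
  also have "\<dots> \<le> (\<integral>\<^sup>+w. ennreal (l (norm (w - y))) \<partial>m)"
    by (intro nn_integral_mono) (auto simp: indicator_def)
  also have "\<dots> \<le> (\<integral>\<^sup>+w. (\<Sum>j. ennreal (decay l s j) * indicator (cell_of s -` region j (anc j (cell_of s y))) w) \<partial>m)"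
    by (intro nn_integral_mono path_loss_le_decay)
  also have "\<dots> = (\<Sum>j. ennreal (decay l s j) * emeasure m (cell_of s -` region j (anc j (cell_of s y))))"
    using cell_of_vimage_borel[OF s] assms
    by (simp add: nn_integral_suminf nn_integral_cmult_indicator)
  finally show ?thesis .
qed

text \<open>Comparison with the integral of \<open>x * l x\<close> over the shells between
  \<open>a j\<close> and \<open>a (Suc j)\<close>: by monotonicity the integrand there is at least
  \<open>a j * l (a (Suc j))\<close>.\<close>

lemma summable_decay:
  assumes "set_integrable lborel {0..} (\<lambda>x. x * l x)"
  shows "summable (\<lambda>j. decay l s j * (s * 7 ^ j)\<^sup>2)"
proof -
  define g where "g x = ennreal (indicator {0..} x * (x * l x))" for x
  define a where "a j = s * 7 ^ j" for j
  have a: "0 < a j" "a j < a (Suc j)" for j using s by (simp_all add: a_def)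
  define I where "I j = {..<a (Suc j)} - {..<a j}" for j
  have int: "integrable lborel (\<lambda>x. indicator {0..} x * (x * l x))"
    using assms by (simp add: set_integrable_def)
  then have [measurable]: "g \<in> borel_measurable lborel" unfolding g_def by measurable
  have fin: "(\<integral>\<^sup>+x. g x \<partial>lborel) < \<infinity>"
  proof -
    have "g x = ennreal (norm (indicator {0..} x * (x * l x)))" for x
      using pos[of x] by (auto simp: g_def indicator_def)
    then show ?thesis using int unfolding integrable_iff_bounded by simp
  qed
  have "disjoint_family I" unfolding I_def
    using a(2) by (intro disjoint_family_Suc) (auto intro: less_imp_le)
  moreover have "range I \<subseteq> sets (density lborel g)" by (auto simp: I_def)
  ultimately have "(\<Sum>j. emeasure (density lborel g) (I j)) = emeasure (density lborel g) (\<Union>j. I j)"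
    by (intro suminf_emeasure)
  moreover have "emeasure (density lborel g) (\<Union>j. I j) \<le> emeasure (density lborel g) (space (density lborel g))"
    by (rule emeasure_space)
  moreover have "emeasure (density lborel g) (space (density lborel g)) = (\<integral>\<^sup>+x. g x \<partial>lborel)"
    by (subst emeasure_density) simp_all
  ultimately have sumI: "(\<Sum>j. emeasure (density lborel g) (I j)) < \<infinity>" using fin by (metis order_le_less_trans)
  define f where "f j = a j * l (a (Suc j)) * (a (Suc j) - a j)" for j
  have f0: "0 \<le> f j" for j using a[of j] a(1)[of "Suc j"] pos[of "a (Suc j)"] by (simp add: f_def)
  have "ennreal (f j) \<le> emeasure (density lborel g) (I j)" for j
  proof -
    have I: "I j = {a j..<a (Suc j)}" unfolding I_def by auto
    have "ennreal (f j) = (\<integral>\<^sup>+x. ennreal (a j * l (a (Suc j))) * indicator {a j..<a (Suc j)} x \<partial>lborel)"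
      using a[of j] pos[of "a (Suc j)"] a(1)[of "Suc j"]
      by (simp add: nn_integral_cmult_indicator f_def ennreal_mult)
    also have "\<dots> \<le> (\<integral>\<^sup>+x. g x * indicator (I j) x \<partial>lborel)"
    proof (rule nn_integral_mono)
      fix x
      show "ennreal (a j * l (a (Suc j))) * indicator {a j..<a (Suc j)} x \<le> g x * indicator (I j) x"
      proof (cases "x \<in> I j")
        case True
        then have x: "a j \<le> x" "x \<le> a (Suc j)" "0 \<le> x" using a(1)[of j] by (auto simp: I)
        have "a j * l (a (Suc j)) \<le> x * l x"
          using x decr'[of x "a (Suc j)"] a(1)[of "Suc j"] pos[of "a (Suc j)"] by (intro mult_mono) auto
        then show ?thesis using True x by (simp add: g_def I ennreal_leI)
      qed (simp add: I)
    qed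
    also have "\<dots> = emeasure (density lborel g) (I j)" by (simp add: emeasure_density I)
    finally show ?thesis .
  qed
  then have "(\<Sum>j. ennreal (f j)) \<le> (\<Sum>j. emeasure (density lborel g) (I j))"
    by (intro suminf_le) auto
  with sumI have "(\<Sum>j. ennreal (f j)) \<noteq> top" by (auto simp: top_unique)
  then have "summable f" using f0 by (intro summable_suminf_not_top)
  then have "summable (\<lambda>j. 2401 / 6 * f j)" by (rule summable_mult)
  \<comment> \<open>The shell has length \<open>6 * a j\<close>, so \<open>f j\<close> is
    \<open>6 * (a j)\<^sup>2 * l (a (Suc j))\<close>. The shift by 2 turns
    \<open>(a j)\<^sup>2\<close> into \<open>7 ^ 4 = 2401\<close> times itself and
    \<open>decay\<close> into \<open>l (a (Suc j))\<close>.\<close>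
  moreover have "2401 / 6 * f j = decay l s (j + 2) * (s * 7 ^ (j + 2))\<^sup>2" for j
    by (simp add: f_def a_def power2_eq_square algebra_simps)
  ultimately have "summable (\<lambda>j. decay l s (j + 2) * (s * 7 ^ (j + 2))\<^sup>2)" by (simp only:)
  then show ?thesis using summable_iff_shift[of "\<lambda>j. decay l s j * (s * 7 ^ j)\<^sup>2" 2] by (simp only:)
qed

text \<open>One vertex is chosen in each cell of \<open>S\<close>. Vertices in adjacent cells are at
  distance at most \<open>4 * s\<close> and, by the power condition, joined by an edge; distinct
  cells give distinct vertices, so the component is infinite.\<close>

lemma percolates_cells:
  assumes mB: "mB \<in> radon_counting_measures" and mI: "mI \<in> radon_counting_measures"
    and "0 < N" "0 < T" "0 < P" "0 < \<gamma>" "0 \<le> H"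
    and S: "con adj S" "infinite S"
    and occupied: "\<And>z. z \<in> S \<Longrightarrow> emeasure mB (cell_of s -` {z}) \<noteq> 0"
    and quiet: "\<And>z. z \<in> S \<Longrightarrow> (\<Sum>j. ennreal (decay l s j) * emeasure mI (cell_of s -` region j (anc j z))) \<le> ennreal H"
    and power: "T * (N + \<gamma> * P * H) < P * l (4 * s)"
  shows "percolates (sinr_graph l N P T mB mI \<gamma>)"
proof -
  have "\<exists>p. cell_of s p = z \<and> p \<in> points mB" if "z \<in> S" for z
    using counting_measure_atom[OF mB _ _ occupied[OF that]] cell_of_vimage_borel[OF s, of "{z}"] bounded_cells[OF s, of "{z}"]
    by auto
  then obtain f where f: "\<And>z. z \<in> S \<Longrightarrow> cell_of s (f z) = z" "\<And>z. z \<in> S \<Longrightarrow> f z \<in> points mB" by metis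
  have inj: "inj_on f S" using f(1) by (metis inj_onI)
  have setsI: "sets mI = sets borel" using mI by (simp add: radon_counting_measures_def)
  \<comment> \<open>The transmitter \<open>x\<close> is arbitrary, so this serves both directions of
    an edge.\<close>
  have sinr: "ennreal T < sinr l N P x (f z) mI \<gamma>" if z: "z \<in> S" and d: "norm (x - f z) \<le> 4 * s" for x z
  proof -
    let ?I = "interference l (remove_point x mI) (f z)"
    have "?I \<le> ennreal H" using interference_le[OF setsI, of x "f z"] quiet[OF z] f(1)[OF z] by simp
    then obtain h where h: "?I = ennreal h" "0 \<le> h" "h \<le> H"
      using assms(7) by (cases ?I) (auto simp: top_unique ennreal_le_iff)
    have den: "ennreal N + ennreal (\<gamma> * P) * ?I = ennreal (N + \<gamma> * P * h)"
      using assms(3,5,6) h by (simp add: ennreal_mult[symmetric] ennreal_plus[symmetric] del: ennreal_plus)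
    have Npos: "0 < N + \<gamma> * P * h" using assms(3,5,6) h by (simp add: add_pos_nonneg)
    have "T * (N + \<gamma> * P * h) \<le> T * (N + \<gamma> * P * H)" using assms(3-6) h by simp
    also have "\<dots> < P * l (norm (x - f z))"
      using power decr'[OF norm_ge_zero d] assms(5) by (meson less_le_trans mult_left_mono less_imp_le)
    finally have "T < P * l (norm (x - f z)) / (N + \<gamma> * P * h)" using Npos by (simp add: pos_less_divide_eq)
    moreover have "0 \<le> P * l (norm (x - f z))" using pos[OF norm_ge_zero, of "x - f z"] assms(5) by simp
    ultimately show ?thesis unfolding sinr_def den using Npos assms(4)
      by (simp add: divide_ennreal ennreal_less_iff)
  qed
  let ?E = "snd (sinr_graph l N P T mB mI \<gamma>)"
  have edge: "f a = f b \<or> (f a, f b) \<in> ?E" if "a \<in> S" "b \<in> S" "(a, b) \<in> adj" for a b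
  proof -
    have "norm (f a - f b) \<le> 4 * s" using norm_adj_cells[OF s, of "f a" "f b"] f(1) that by simp
    then show ?thesis using sinr[OF that(2), of "f a"] sinr[OF that(1), of "f b"] f(2) that
      by (auto simp: sinr_graph_def norm_minus_commute)
  qed
  have path: "(f a, f b) \<in> ?E\<^sup>*" if "(a, b) \<in> (adj \<inter> S \<times> S)\<^sup>*" for a b
    using that
  proof (induction rule: rtrancl_induct)
    case (step b c)
    then show ?case using edge[of b c] by (auto intro: rtrancl_into_rtrancl)
  qed simp
  obtain z0 where z0: "z0 \<in> S" using S(2) by (metis ex_in_conv finite.emptyI)
  let ?C = "{y. (f z0, y) \<in> ?E\<^sup>*}"
  have "f ` S \<subseteq> ?C" using path S(1) z0 unfolding con_def by blast
  moreover have "infinite (f ` S)" using inj S(2) by (simp add: finite_image_iff)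
  ultimately have "infinite ?C" using finite_subset by blast
  moreover have "?C \<in> graph_components (sinr_graph l N P T mB mI \<gamma>)"
    unfolding graph_components_def using f(2)[OF z0] by (auto simp: sinr_graph_def)
  ultimately show ?thesis unfolding percolates_def by blast
qed

end

section \<open>Percolation\<close>

text \<open>The event is contained both in the emptiness of all its cells and in the crowding of all
  its regions. Each is bounded by the hypothesis on one process alone, and
  \<open>le_cert_bound\<close> combines the two.\<close>

lemma prob_cert_le:
  fixes lam \<tau> :: "nat \<Rightarrow> real" and d :: cert
  assumes M: "prob_space M"
    and \<Phi>: "point_process M \<Phi>" "nu_weakly_sub_poisson M \<Phi>" "has_intensity M \<Phi> c" "0 < c"
    and \<Psi>: "point_process M \<Psi>" "alpha_weakly_sub_poisson M \<Psi>" "has_intensity M \<Psi> \<mu>" "0 < \<mu>"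
    and s: "0 < s" and lam: "\<And>j. 0 < lam j" and \<tau>: "\<And>j. 0 < \<tau> j"
  defines "\<delta> \<equiv> \<lambda>j. sqrt (9 * \<mu> * (lam j * (s * 7 ^ j)\<^sup>2) / \<tau> j)"
    and "A \<equiv> {\<omega> \<in> space M. occ (\<lambda>z. emeasure (\<Phi> \<omega>) (cell_of s -` {z}) = 0)
      (\<lambda>j x. ennreal (\<tau> j) < ennreal (lam j) * emeasure (\<Psi> \<omega>) (cell_of s -` region j x)) d}"
  assumes \<delta>: "\<And>j. \<delta> j \<le> 1" and d: "d \<in> certs k x"
  shows "A \<in> sets M" "measure M A \<le> cert_bound (exp (- (c * s\<^sup>2 / 2))) \<delta> d"
proof -
  interpret prob_space M by fact
  let ?E = "\<lambda>z \<omega>. emeasure (\<Phi> \<omega>) (cell_of s -` {z}) = 0"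
  let ?D = "\<lambda>j x \<omega>. ennreal (\<tau> j) < ennreal (lam j) * emeasure (\<Psi> \<omega>) (cell_of s -` region j x)"
  have E: "{\<omega> \<in> space M. ?E z \<omega>} \<in> sets M" for z
  proof -
    have [measurable]: "(\<lambda>\<omega>. emeasure (\<Phi> \<omega>) (cell_of s -` {z})) \<in> borel_measurable M"
      using s by (intro point_process_count_measurable[OF \<Phi>(1)] cell_of_vimage_borel bounded_cells) auto
    show ?thesis by measurable
  qed
  have D: "{\<omega> \<in> space M. ?D j x \<omega>} \<in> sets M" for j x
  proof -
    have [measurable]: "(\<lambda>\<omega>. emeasure (\<Psi> \<omega>) (cell_of s -` region j x)) \<in> borel_measurable M"
      using s by (intro point_process_count_measurable[OF \<Psi>(1)] cell_of_vimage_borel bounded_region) auto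
    show ?thesis by measurable
  qed
  let ?AE = "{\<omega> \<in> space M. \<forall>z\<in>set (emps d). ?E z \<omega>}"
  let ?AD = "{\<omega> \<in> space M. \<forall>(j, x)\<in>set (discs d). ?D j x \<omega>}"
  have meas: "?AE \<in> sets M" "?AD \<in> sets M"
    using E D by (intro sets.sets_Collect_finite_All; force)+
  have A: "A = ?AE \<inter> ?AD" unfolding A_def occ_iff by auto
  show "A \<in> sets M" unfolding A using meas by auto
  note dr = certs_region[OF d]
  have "measure M A \<le> measure M ?AE"
    unfolding A by (intro finite_measure_mono Int_lower1 meas)
  also have "\<dots> \<le> exp (- (c * s\<^sup>2)) ^ card (set (emps d))"
    by (rule prob_empty_cells[OF M \<Phi> s]) simp
  \<comment> \<open>Distinctness of the cells turns the cardinality into the length; halving the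
    exponent gives the square root of a void bound.\<close>
  also have "\<dots> = ((exp (- (c * s\<^sup>2 / 2)))\<^sup>2) ^ length (emps d)"
    using dr by (simp add: distinct_card exp_double[symmetric])
  finally have 1: "measure M A \<le> ((exp (- (c * s\<^sup>2 / 2)))\<^sup>2) ^ length (emps d)" .
  have "measure M A \<le> measure M ?AD"
    unfolding A by (intro finite_measure_mono Int_lower2 meas)
  also have "\<dots> \<le> (\<Prod>(j, x)\<leftarrow>discs d. 9 * \<mu> * (lam j * (s * 7 ^ j)\<^sup>2) / \<tau> j)"
    using dr by (intro prob_crowded_regions[OF M \<Psi> s lam \<tau>]) simp
  also have "\<dots> = disc_prod \<delta> d"
  proof -
    have "0 \<le> 9 * \<mu> * (lam j * (s * 7 ^ j)\<^sup>2) / \<tau> j" for j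
      using lam[of j] \<tau>[of j] \<Psi>(4) by simp
    then show ?thesis unfolding disc_prod_def \<delta>_def by simp
  qed
  finally have 2: "measure M A \<le> disc_prod \<delta> d" .
  have "0 \<le> \<delta> j" for j using lam[of j] \<tau>[of j] \<Psi>(4) by (simp add: \<delta>_def)
  then show "measure M A \<le> cert_bound (exp (- (c * s\<^sup>2 / 2))) \<delta> d"
    using 1 2 \<delta> \<Phi>(4) by (intro le_cert_bound) auto
qed

context path_loss
begin

text \<open>The deterministic part. The interference at a core cell of level \<open>k\<close> splits
  by scale: up to level \<open>k\<close> good ancestors bound it by the thresholds, with sum at most
  \<open>H\<close>; above it, the ancestor is always \<open>(0, 0)\<close>, and the tail of one
  convergent series is below 1.\<close>

lemma percolates_eventually_good:
  fixes \<tau> :: "nat \<Rightarrow> nat \<Rightarrow> real"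
  assumes mB: "mB \<in> radon_counting_measures" and mI: "mI \<in> radon_counting_measures"
    and NTP: "0 < N" "0 < T" "0 < P" "0 < \<gamma>" and H: "0 \<le> H"
    and power: "T * (N + \<gamma> * P * (H + 1)) < P * l (4 * s)"
    and \<tau>: "\<And>k j. \<tau> (Suc k) j \<le> \<tau> k j" "\<And>k. (\<Sum>j\<le>k. \<tau> k j) \<le> H" "\<And>k j. 0 \<le> \<tau> k j"
    and fin: "(\<Sum>j. ennreal (decay l s j) * emeasure mI (cell_of s -` region j (0, 0))) < \<infinity>"
  defines "e \<equiv> \<lambda>z. emeasure mB (cell_of s -` {z}) = 0"
    and "D \<equiv> \<lambda>k j x. ennreal (\<tau> k j) < ennreal (decay l s j) * emeasure mI (cell_of s -` region j x)"
  assumes good: "eventually (\<lambda>k. \<forall>y. par y = (0, 0) \<longrightarrow> \<not> bad e (D k) k y) sequentially"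
  shows "percolates (sinr_graph l N P T mB mI \<gamma>)"
proof -
  define y where "y j x = ennreal (decay l s j) * emeasure mI (cell_of s -` region j x)" for j x
  have "y j (0, 0) < \<infinity>" for j
    using sum_le_suminf[of "\<lambda>j. y j (0, 0)" "{j}"] fin unfolding y_def by (auto intro: le_less_trans)
  then have "y j (0, 0) \<noteq> top" for j by (simp add: less_top)
  then have "\<exists>u. y j (0, 0) = ennreal u \<and> 0 \<le> u" for j by (metis ennreal_cases)
  then obtain u where u: "\<And>j. y j (0, 0) = ennreal (u j)" "\<And>j. 0 \<le> u j" by metis
  have su: "summable u"
    using fin u(2) by (intro summable_suminf_not_top) (auto simp: y_def[symmetric] u(1))
  obtain n where n: "\<And>k. n \<le> k \<Longrightarrow> (\<Sum>i. u (i + k)) < 1"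
    using suminf_exist_split[OF zero_less_one su] by (auto simp: abs_less_iff)
  obtain k1 where k1: "\<And>k y. k1 \<le> k \<Longrightarrow> par y = (0, 0) \<Longrightarrow> \<not> bad e (D k) k y"
    using good by (auto simp: eventually_sequentially)
  define k0 where "k0 = max n k1"
  define S where "S = (\<Union>k\<in>{k0..}. \<Union>y\<in>{y. par y = (0, 0)}. core e (D k) k y)"
  have mono: "D k j x \<Longrightarrow> D (Suc k) j x" for k j x
    unfolding D_def using \<tau>(1)[of k j] by (meson ennreal_leI le_less_trans)
  have S: "con adj S" "infinite S"
    unfolding S_def by (rule infinite_core_union; use mono k1 in \<open>auto simp: k0_def\<close>)+
  have cells: "emeasure mB (cell_of s -` {z}) \<noteq> 0 \<and> (\<Sum>j. y j (anc j z)) \<le> ennreal (H + 1)" if zS: "z \<in> S" for z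
  proof -
    obtain k x where k: "k0 \<le> k" "par x = (0, 0)" "z \<in> core e (D k) k x" using zS unfolding S_def by blast
    have nb: "\<not> bad e (D k) k x" using k k1 by (simp add: k0_def)
    have gd: "\<not> bad e (D k) j (anc j z)" if "j \<le> k" for j using core_good[OF k(3) nb that] .
    have occ: "emeasure mB (cell_of s -` {z}) \<noteq> 0" using gd[of 0] by (simp add: e_def)
    have low: "y j (anc j z) \<le> ennreal (\<tau> k j)" if "j \<le> k" for j
    proof -
      have "\<not> D k j (anc j z)" using gd[OF that] bad_imp_disc by blast
      then show ?thesis by (simp add: D_def y_def not_less)
    qed
    \<comment> \<open>The ancestor of level \<open>k\<close> is one of the 49 boxes, whose parent
      \<open>(0, 0)\<close> is its own parent.\<close>
    have "anc (i + Suc k) z = (0, 0)" for i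
      by (induction i) (simp_all add: anc_Suc core_anc[OF k(3)] k(2))
    then have high: "y (i + Suc k) (anc (i + Suc k) z) = ennreal (u (i + Suc k))" for i
      by (simp only: u(1))
    have "(\<Sum>j. y j (anc j z)) = (\<Sum>i. y (i + Suc k) (anc (i + Suc k) z)) + (\<Sum>j<Suc k. y j (anc j z))"
      by (rule suminf_offset) simp
    also have "(\<Sum>i. y (i + Suc k) (anc (i + Suc k) z)) = ennreal (\<Sum>i. u (i + Suc k))"
      unfolding high by (rule suminf_ennreal2[OF u(2) summable_ignore_initial_segment[OF su]])
    also have "\<dots> \<le> ennreal 1"
      using n[of "Suc k"] k(1) by (intro ennreal_leI) (simp add: k0_def)
    also have "(\<Sum>j<Suc k. y j (anc j z)) \<le> (\<Sum>j<Suc k. ennreal (\<tau> k j))"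
      using low by (intro sum_mono) simp
    also have "\<dots> = ennreal (\<Sum>j\<le>k. \<tau> k j)"
      using \<tau>(3) by (simp add: lessThan_Suc_atMost)
    also have "\<dots> \<le> ennreal H" using \<tau>(2) by (rule ennreal_leI)
    also have "ennreal 1 + ennreal H = ennreal (H + 1)" using H by (simp add: add.commute)
    finally show ?thesis using occ by (simp add: add_mono)
  qed
  show ?thesis
    using cells H power NTP unfolding y_def by (intro percolates_cells[OF mB mI _ _ _ _ _ S, of _ _ _ _ "H + 1"]) auto
qed

end

theorem theorem3p13:
  fixes M :: "'w measure"
    and \<Phi> \<Phi>I :: "'w \<Rightarrow> (real^2) measure"
    and l :: "real \<Rightarrow> real"
    and N T c \<mu> :: real
  assumes "N > 0" and "T > 0"
    and "continuous_on {0..} l"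
    and "strict_antimono_on {0..} l"
    and "\<And>x. x \<ge> 0 \<Longrightarrow> l x > 0"
    and "\<And>x. x \<ge> 0 \<Longrightarrow> l x \<le> 1"
    and "set_integrable lborel {0..} (\<lambda>x. x * l x)"
    and "prob_space M"
    and "point_process M \<Phi>" and "stationary M \<Phi>" and "nu_weakly_sub_poisson M \<Phi>"
    and "c > 0" and "has_intensity M \<Phi> c"
    and "point_process M \<Phi>I" and "alpha_weakly_sub_poisson M \<Phi>I"
    and "\<mu> > 0" and "has_intensity M \<Phi>I \<mu>"
  shows "\<exists>P>0. l 0 \<ge> T * N / P \<and>
           (\<exists>\<gamma>>0. AE \<omega> in M. percolates (sinr_graph l N P T (\<Phi> \<omega>) (\<Phi>I \<omega>) \<gamma>))"
proof -
  interpret prob_space M by fact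
  \<comment> \<open>Chosen so that \<open>r = exp (- (c * s\<^sup>2 / 2))\<close> equals the value
    1/80000 allowed by \<open>sum_cert_weight\<close>.\<close>
  define s where "s = sqrt (2 * ln 80000 / c)"
  have s: "0 < s" using assms(12) by (simp add: s_def)
  define r where "r = exp (- (c * s\<^sup>2 / 2))"
  have "c * s\<^sup>2 / 2 = ln 80000" using assms(12) by (simp add: s_def)
  then have r: "r = 1 / 80000" by (simp add: r_def exp_minus inverse_eq_divide)
  interpret path_loss l s by unfold_locales (use assms(3-6) s in auto)
  define b where "b j = decay l s j * (s * 7 ^ j)\<^sup>2" for j
  have b: "0 < b j" for j using decay_pos[of j] s by (simp add: b_def)
  have sb: "summable b" unfolding b_def using summable_decay[OF assms(7)] .
  \<comment> \<open>The factor \<open>160000\<^sup>2\<close> makes every \<open>\<delta> k j\<close>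
    at most 1/160000.\<close>
  define K where "K = 9 * \<mu> * 160000\<^sup>2"
  have K: "0 < K" using assms(16) by (simp add: K_def)
  \<comment> \<open>With \<open>K * b j\<close> alone the disc events would have the same probability at all levels. The extra
    term makes the probability at level \<open>j\<close> of order \<open>b j * 2 ^ (k - j)\<close>, a growth which the factor
    \<open>8\<close> gained at each level above \<open>j\<close> absorbs, while the sum over \<open>j\<close> stays bounded in \<open>k\<close>.\<close>
  define \<tau> where "\<tau> k j = K * (b j + (1 / 2) ^ (k - j))" for k j :: nat
  have \<tau>: "0 < \<tau> k j" for k j using K b[of j] by (simp add: \<tau>_def add_pos_pos)
  define \<delta> where "\<delta> k j = sqrt (9 * \<mu> * (decay l s j * (s * 7 ^ j)\<^sup>2) / \<tau> k j)" for k j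
  have \<delta>_sq: "(\<delta> k j)\<^sup>2 = 9 * \<mu> * b j / \<tau> k j" for k j
    using assms(16) \<tau>[of k j] b[of j] by (simp add: \<delta>_def b_def[symmetric])
  have \<delta>_le: "\<delta> k j \<le> 1 / 160000" for k j
  proof (rule power2_le_imp_le)
    have "b j / (b j + (1 / 2) ^ (k - j)) \<le> 1" using b[of j] by (simp add: add_pos_pos)
    moreover have "(\<delta> k j)\<^sup>2 = (1 / 160000)\<^sup>2 * (b j / (b j + (1 / 2) ^ (k - j)))"
    proof -
      have "m * x / (m * C\<^sup>2 * y) = (1 / C)\<^sup>2 * (x / y)" if "m \<noteq> 0" for m x C y :: real
        using that by (simp add: power_divide)
      then show ?thesis
        unfolding \<delta>_sq \<tau>_def K_def by this (use assms(16) in simp)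
    qed
    ultimately show "(\<delta> k j)\<^sup>2 \<le> (1 / 160000)\<^sup>2" by (simp only: mult_left_le zero_le_power2)
  qed simp
  have \<delta>_nn: "0 \<le> \<delta> k j" for k j
    using assms(16) \<tau>[of k j] b[of j] by (simp add: \<delta>_def b_def[symmetric])
  \<comment> \<open>Only the geometric term of the threshold is kept in the denominator.\<close>
  have \<delta>_dec: "(\<delta> k j)\<^sup>2 \<le> b j * 2 ^ (k - j)" for k j
  proof -
    have "9 * \<mu> \<le> K" using assms(16) by (simp add: K_def)
    then have "9 * \<mu> * b j \<le> K * b j" using b[of j] by simp
    also have "\<dots> = (b j * 2 ^ (k - j)) * (K * (1 / 2) ^ (k - j))" by (simp add: power_one_over)
    also have "\<dots> \<le> (b j * 2 ^ (k - j)) * \<tau> k j" using K b[of j] by (simp add: \<tau>_def)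
    finally show ?thesis unfolding \<delta>_sq using \<tau>[of k j] by (simp add: pos_divide_le_eq)
  qed
  define e where "e \<omega> z \<longleftrightarrow> emeasure (\<Phi> \<omega>) (cell_of s -` {z}) = 0" for \<omega> z
  define D where "D k \<omega> j x \<longleftrightarrow>
    ennreal (\<tau> k j) < ennreal (decay l s j) * emeasure (\<Phi>I \<omega>) (cell_of s -` region j x)" for k \<omega> j x
  define F where "F k d = {\<omega> \<in> space M. occ (e \<omega>) (D k \<omega>) d}" for k d
  define Ev where "Ev k = (\<Union>y\<in>{y. par y = (0, 0)}. \<Union>d\<in>certs k y. F k d)" for k
  have \<delta>1: "\<delta> k j \<le> 1" for k j using \<delta>_le[of k j] by simp
  have F: "F k d \<in> sets M" "measure M (F k d) \<le> cert_bound r (\<delta> k) d" if "d \<in> certs k y" for k d y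
    using prob_cert_le[where lam = "decay l s" and \<tau> = "\<tau> k",
        OF assms(8,9,11,13,12,14,15,17,16) s decay_pos \<tau> \<delta>1[unfolded \<delta>_def] that]
    unfolding F_def e_def D_def r_def \<delta>_def by blast+
  have UF: "(\<Union>d\<in>certs k y. F k d) \<in> sets M" for k y
    using F(1) by (intro sets.finite_UN finite_certs)
  have Ev: "Ev k \<in> sets M" for k
    unfolding Ev_def by (intro sets.finite_UN finite_children UF)
  \<comment> \<open>The ratio 1/4 is the gain 1/8 per level times the growth 2 from
    \<open>\<delta>_dec\<close>.\<close>
  define v where "v k = (1 / 8) ^ k + (\<Sum>j\<le>k. b j * (1 / 4) ^ (k - j))" for k
  have Ev_le: "measure M (Ev k) \<le> 49 * v k" for k
  proof -
    have "measure M (Ev k) \<le> (\<Sum>y | par y = (0, 0). measure M (\<Union>d\<in>certs k y. F k d))"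
      unfolding Ev_def using UF by (intro finite_measure_subadditive_finite finite_children) blast
    also have "\<dots> \<le> (\<Sum>y | par y = (0, 0). v k)"
    proof (rule sum_mono)
      fix y
      have "measure M (\<Union>d\<in>certs k y. F k d) \<le> (\<Sum>d\<in>certs k y. measure M (F k d))"
        using F(1) by (intro finite_measure_subadditive_finite finite_certs) blast
      also have "\<dots> \<le> (\<Sum>d\<in>certs k y. cert_bound r (\<delta> k) d)"
        by (intro sum_mono F(2))
      also have "\<dots> \<le> (1 / 8) ^ k * r + (\<Sum>j\<le>k. (1 / 8) ^ (k - j) * (\<delta> k j)\<^sup>2)"
        using \<delta>_nn \<delta>1 \<delta>_le by (intro sum_cert_bound) (simp_all add: r)
      also have "\<dots> \<le> v k"
        unfolding v_def
      proof (intro add_mono sum_mono)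
        show "(1 / 8) ^ k * r \<le> (1 / 8) ^ k" by (simp add: r)
        fix j
        have "(1 / 8) ^ (k - j) * (\<delta> k j)\<^sup>2 \<le> (1 / 8) ^ (k - j) * (b j * 2 ^ (k - j))"
          using \<delta>_dec by (intro mult_left_mono) auto
        also have "\<dots> = b j * ((1 / 8) * 2) ^ (k - j)" by (simp only: power_mult_distrib mult_ac)
        finally show "(1 / 8) ^ (k - j) * (\<delta> k j)\<^sup>2 \<le> b j * (1 / 4) ^ (k - j)" by simp
      qed
      finally show "measure M (\<Union>d\<in>certs k y. F k d) \<le> v k" .
    qed
    also have "\<dots> = 49 * v k" by (simp add: card_children)
    finally show ?thesis .
  qed
  \<comment> \<open>Cauchy product of the summable \<open>b\<close> with a geometric series.\<close>
  have "summable (\<lambda>k. 49 * v k)"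
  proof -
    have "summable (\<lambda>k. \<Sum>j\<le>k. b j * (1 / 4) ^ (k - j))"
      using sb b by (intro summable_Cauchy_product) (simp_all add: less_imp_le)
    then show ?thesis unfolding v_def by (intro summable_mult summable_add) simp_all
  qed
  then have "summable (\<lambda>k. measure M (Ev k))"
    by (rule summable_comparison_test'[of _ 0]) (use Ev_le in simp)
  then have AE1: "AE \<omega> in M. eventually (\<lambda>k. \<omega> \<in> space M - Ev k) sequentially"
    using Ev by (intro borel_cantelli_AE1) (auto simp: less_top[symmetric])
  \<comment> \<open>The weighted counts around the origin have expected sum \<open>9 * \<mu>\<close>
    times the sum of \<open>b\<close>, so the sum is almost surely finite.\<close>
  have AE2: "AE \<omega> in M. (\<Sum>j. ennreal (decay l s j) * emeasure (\<Phi>I \<omega>) (cell_of s -` region j (0, 0))) \<noteq> \<infinity>"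
  proof (rule nn_integral_PInf_AE)
    have [measurable]: "(\<lambda>\<omega>. emeasure (\<Phi>I \<omega>) (cell_of s -` region j (0, 0))) \<in> borel_measurable M" for j
      using s by (intro point_process_count_measurable[OF assms(14)] cell_of_vimage_borel bounded_region) auto
    show "(\<lambda>\<omega>. \<Sum>j. ennreal (decay l s j) * emeasure (\<Phi>I \<omega>) (cell_of s -` region j (0, 0))) \<in> borel_measurable M"
      by measurable
    have "(\<integral>\<^sup>+\<omega>. ennreal (decay l s j) * emeasure (\<Phi>I \<omega>) (cell_of s -` region j (0, 0)) \<partial>M) = ennreal (9 * \<mu> * b j)" for j
    proof -
      have "(\<integral>\<^sup>+\<omega>. emeasure (\<Phi>I \<omega>) (cell_of s -` region j (0, 0)) \<partial>M) = ennreal \<mu> * ennreal (9 * (s * 7 ^ j)\<^sup>2)"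
        using assms(17) cell_of_vimage_borel[OF s]
        by (simp add: has_intensity_def mean_count_def emeasure_region[OF s])
      then show ?thesis
        using decay_pos[of j] assms(16) by (simp add: nn_integral_cmult ennreal_mult[symmetric] b_def mult_ac)
    qed
    then have "(\<integral>\<^sup>+\<omega>. (\<Sum>j. ennreal (decay l s j) * emeasure (\<Phi>I \<omega>) (cell_of s -` region j (0, 0))) \<partial>M)
        = (\<Sum>j. ennreal (9 * \<mu> * b j))"
      by (simp add: nn_integral_suminf)
    also have "\<dots> = ennreal (\<Sum>j. 9 * \<mu> * b j)"
      using sb b assms(16) by (intro suminf_ennreal2) (auto simp: less_imp_le)
    finally show "(\<integral>\<^sup>+\<omega>. (\<Sum>j. ennreal (decay l s j) * emeasure (\<Phi>I \<omega>) (cell_of s -` region j (0, 0))) \<partial>M) \<noteq> \<infinity>"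
      by simp
  qed
  \<comment> \<open>The 2 bounds the sum of the geometric terms of the thresholds, uniformly in
    \<open>k\<close>.\<close>
  define H where "H = K * (suminf b + 2)"
  have H: "0 \<le> H" using K sb b by (simp add: H_def suminf_nonneg less_imp_le)
  have \<tau>_sum: "(\<Sum>j\<le>k. \<tau> k j) \<le> H" for k
  proof -
    have "(\<Sum>j\<le>k. b j) \<le> suminf b" using sb b by (intro sum_le_suminf) (auto simp: less_imp_le)
    moreover have "(\<Sum>j\<le>k. (1 / 2 :: real) ^ (k - j)) \<le> 2"
    proof -
      have "(\<Sum>j\<le>k. (1 / 2 :: real) ^ (k - j)) = (\<Sum>j\<le>k. (1 / 2) ^ j)"
        by (rule sum.reindex_bij_witness[of _ "\<lambda>j. k - j" "\<lambda>j. k - j"]) auto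
      also have "\<dots> \<le> (\<Sum>j. (1 / 2) ^ j)" by (intro sum_le_suminf) auto
      also have "\<dots> = 2" by (simp add: suminf_geometric)
      finally show ?thesis .
    qed
    ultimately show ?thesis using K by (simp add: \<tau>_def H_def sum_distrib_left[symmetric] sum.distrib)
  qed
  \<comment> \<open>Truncated subtraction gives exponent 0 for \<open>j > k\<close>, so the
    monotonicity holds for these \<open>j\<close> as well.\<close>
  have \<tau>_mono: "\<tau> (Suc k) j \<le> \<tau> k j" for k j
    using K unfolding \<tau>_def by (intro mult_left_mono add_left_mono power_decreasing) auto
  \<comment> \<open>The received power across adjacent cells is then at least
    \<open>3 * T * N\<close>, while \<open>\<gamma>\<close> makes the interference term at most
    \<open>N\<close>, so that \<open>2 * T * N < 3 * T * N\<close> suffices.\<close>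
  define P where "P = 3 * T * N / l (4 * s)"
  define \<gamma> where "\<gamma> = N / (P * (H + 1))"
  have l4: "0 < l (4 * s)" using s by (intro assms(5)) simp
  have P: "0 < P" using assms(1,2) l4 by (simp add: P_def)
  have \<gamma>: "0 < \<gamma>" using assms(1) P H by (simp add: \<gamma>_def)
  have "\<gamma> * P * (H + 1) = N" using P H by (simp add: \<gamma>_def)
  moreover have Pl: "P * l (4 * s) = 3 * T * N" using l4 by (simp add: P_def)
  ultimately have power: "T * (N + \<gamma> * P * (H + 1)) < P * l (4 * s)" using assms(1,2) by simp
  have "AE \<omega> in M. percolates (sinr_graph l N P T (\<Phi> \<omega>) (\<Phi>I \<omega>) \<gamma>)"
    using AE1 AE2 AE_space
  proof eventually_elim
    case (elim \<omega>)
    have "eventually (\<lambda>k. \<forall>y. par y = (0, 0) \<longrightarrow> \<not> bad (e \<omega>) (D k \<omega>) k y) sequentially"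
      using elim(1)
    proof eventually_elim
      case (elim k)
      then show ?case using bad_imp_cert[of "e \<omega>" "D k \<omega>" k] unfolding Ev_def F_def by blast
    qed
    then show ?case
      using elim(2,3) point_process_radon[OF assms(9)] point_process_radon[OF assms(14)] \<tau>
      unfolding e_def D_def
      by (intro percolates_eventually_good[OF _ _ assms(1,2) P \<gamma> H power \<tau>_mono \<tau>_sum])
        (auto simp: less_imp_le less_top)
  qed
  moreover have "T * N / P \<le> l 0"
  proof -
    have "T * N / P = l (4 * s) / 3" using assms(1,2) l4 by (simp add: P_def)
    also have "\<dots> \<le> l (4 * s)" using l4 by simp
    also have "\<dots> \<le> l 0" using decr'[of 0 "4 * s"] s by simp
    finally show ?thesis .
  qed
  ultimately show ?thesis using P \<gamma> by blast
qed

end
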